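(* Fix $\sigma>0$. As $\ell\to\infty$, $$\frac{1}{\#\mathcal E_\ell(\sigma)}\sum_{n:\ \lambda_n(\sigma)\in\mathcal E_\ell(\sigma)} d_n(\sigma)\sim 2\sigma .$$
   Context: Let $\Omega$ be the closed upper unit hemisphere in $\mathbb R^3$ with coordinates $(\sin\theta\cos\phi,\sin\theta\sin\phi,\cos\theta)$, $0\le\theta\le\pi/2$, $0\le \phi<2\pi$, and boundary the equator $\theta=\pi/2$. For a constant $\sigma\ge0$ the Robin problem is $\Delta F+\lambda F=0$ in $\Omega$, $\frac{\partial F}{\partial n}+\sigma F=0$ on $\partial\Omega$, where $\Delta$ is the Laplace-Beltrami operator and $\partial/\partial n$ the outward normal derivative ($\sigma=0$ is the Neumann problem). It separates into sectors of functions $F=e^{im\phi}f(\cos\theta)$, $m\in\mathbb Z$; since $\pm m$ give the same eigenvalues, the desymmetrized spectrum keeps only the eigenvalues of sectors with $m\ge0$ (an eigenvalue is counted once for each $m\ge 0$ for which it has a nonzero eigenfunction in sector $m$). Let $\lambda_0(\sigma)\le\lambda_1(\sigma)\le\cdots$ be the ordered desymmetrized Robin eigenvalues, repeated with multiplicity, let $\lambda_0(0)\le\lambda_1(0)\le\cdots$ be the ordered desymmetrized Neumann eigenvalues ($0<2<6=6<\cdots$; $\ell(\ell+1)$ has multiplicity $\lfloor \ell/2\rfloor+1$), and put $d_n(\sigma)=\lambda_n(\sigma)-\lambda_n(0)$. For integer $m\ge 0$ define $$S_m(\nu)=2\tan\left(\frac{\pi(m+\nu)}{2}\right)\frac{\Gamma\left(\frac{\nu+m}{2}+1\right)\Gamma\left(\frac{\nu-m}{2}+1\right)}{\Gamma\left(\frac{\nu+m+1}{2}\right)\Gamma\left(\frac{\nu-m+1}{2}\right)}.$$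 For $\sigma>0$ and integers $0\le m\le \ell$ with $m\equiv\ell\pmod 2$, $\nu_{\ell,m}(\sigma)$ is the unique solution of $S_m(\nu)=\sigma$ in $(\ell,\ell+1)$, and $\Lambda_{\ell,m}(\sigma)=\nu_{\ell,m}(\sigma)(\nu_{\ell,m}(\sigma)+1)$. For $\sigma>0$ the desymmetrized Robin spectrum consists of the $\Lambda_{\ell,m}(\sigma)$ and is partitioned into the disjoint clusters $$\mathcal E_\ell(\sigma)=\{\Lambda_{\ell,m}(\sigma):0\le m\le\ell,\ m\equiv\ell \pmod 2\},\qquad \#\mathcal E_\ell(\sigma)=\lfloor \ell/2\rfloor+1 .$$ *)

theory Defs
  imports "HOL-Analysis.Analysis" "HOL-Library.Landau_Symbols"
begin

definition hemisphere :: "(real^3) set" where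
  "hemisphere = {x. norm x = 1 \<and> 0 \<le> x $ 3}"

definition sph :: "real \<Rightarrow> real \<Rightarrow> real^3" where
  "sph \<theta> \<phi> = vector [sin \<theta> * cos \<phi>, sin \<theta> * sin \<phi>, cos \<theta>]"

text \<open>Twice continuously differentiable on the open set \<open>U\<close>; \<open>D\<close> and \<open>D2\<close> are the first and
  second Frechet derivatives.\<close>

definition C2_on :: "(real^3) set \<Rightarrow> (real^3 \<Rightarrow> complex) \<Rightarrow> bool" where
  "C2_on U F \<longleftrightarrow>
     (\<exists>(D :: real^3 \<Rightarrow> ((real^3) \<Rightarrow>\<^sub>L complex)) (D2 :: real^3 \<Rightarrow> ((real^3) \<Rightarrow>\<^sub>L ((real^3) \<Rightarrow>\<^sub>L complex))).
        (\<forall>x\<in>U. (F has_derivative blinfun_apply (D x)) (at x)) \<and>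
        (\<forall>x\<in>U. (D has_derivative blinfun_apply (D2 x)) (at x)) \<and>
        continuous_on U D2)"

text \<open>The Laplace-Beltrami operator of the round metric
  \<open>d\<theta>\<^sup>2 + sin\<^sup>2 \<theta> d\<phi>\<^sup>2\<close> at the point \<open>sph \<theta> \<phi>\<close>, for \<open>sin \<theta> \<noteq> 0\<close>:
  \<open>(1 / sin \<theta>) \<partial>\<^sub>\<theta> (sin \<theta> \<partial>\<^sub>\<theta> F) + (1 / sin\<^sup>2 \<theta>) \<partial>\<^sub>\<phi>\<^sup>2 F\<close>.\<close>

definition laplace_beltrami :: "(real^3 \<Rightarrow> complex) \<Rightarrow> real \<Rightarrow> real \<Rightarrow> complex" where
  "laplace_beltrami F \<theta> \<phi> =
     (1 / sin \<theta>) *\<^sub>R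
       vector_derivative (\<lambda>t. sin t *\<^sub>R vector_derivative (\<lambda>s. F (sph s \<phi>)) (at t)) (at \<theta>) +
     (1 / (sin \<theta>)\<^sup>2) *\<^sub>R
       vector_derivative (\<lambda>t. vector_derivative (\<lambda>s. F (sph \<theta> s)) (at t)) (at \<phi>)"

text \<open>Classical solutions, \<open>C\<^sup>2\<close> up to the boundary (that is, restrictions of functions that are
  \<open>C\<^sup>2\<close> on an open neighbourhood in space). The equation is stated away from the coordinate
  singularity \<open>\<theta> = 0\<close>; at the pole it follows by continuity, since \<open>F\<close> is \<open>C\<^sup>2\<close> there too.
  On the equator the outward unit normal, tangent to the sphere, is \<open>- axis 3 1\<close>.\<close>

definition robin_solution :: "real \<Rightarrow> real \<Rightarrow> (real^3 \<Rightarrow> complex) \<Rightarrow> bool" where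
  "robin_solution \<sigma> \<mu> F \<longleftrightarrow>
     (\<exists>U. open U \<and> hemisphere \<subseteq> U \<and> C2_on U F) \<and>
     (\<forall>\<theta> \<phi>. 0 < \<theta> \<and> \<theta> \<le> pi/2 \<longrightarrow> laplace_beltrami F \<theta> \<phi> + \<mu> *\<^sub>R F (sph \<theta> \<phi>) = 0) \<and>
     (\<forall>p\<in>hemisphere. p $ 3 = 0 \<longrightarrow>
        frechet_derivative F (at p) (- axis 3 1) + \<sigma> *\<^sub>R F p = 0)"

definition in_sector :: "int \<Rightarrow> (real^3 \<Rightarrow> complex) \<Rightarrow> bool" where
  "in_sector m F \<longleftrightarrow>
     (\<exists>f :: real \<Rightarrow> complex. \<forall>\<theta> \<phi>. 0 \<le> \<theta> \<and> \<theta> \<le> pi/2 \<longrightarrow>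
        F (sph \<theta> \<phi>) = exp (\<i> * of_int m * of_real \<phi>) * f (cos \<theta>))"

definition sector_eigenvalue :: "real \<Rightarrow> int \<Rightarrow> real \<Rightarrow> bool" where
  "sector_eigenvalue \<sigma> m \<mu> \<longleftrightarrow>
     (\<exists>F. robin_solution \<sigma> \<mu> F \<and> in_sector m F \<and> (\<exists>p\<in>hemisphere. F p \<noteq> 0))"

text \<open>An eigenvalue occurs in the desymmetrized spectrum once for each sector \<open>m \<ge> 0\<close> in which it
  has an eigenfunction, so multiplicities are kept by pairing it with \<open>m\<close>.\<close>

definition desym_spectrum :: "real \<Rightarrow> (nat \<times> real) set" where
  "desym_spectrum \<sigma> = {(m, \<mu>). sector_eigenvalue \<sigma> (int m) \<mu>}"

text \<open>\<open>desym_eigenvalue \<sigma> n\<close> is \<open>\<lambda>\<^sub>n(\<sigma>)\<close>: the nondecreasing enumeration, with multiplicity, of the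
  desymmetrized eigenvalues (Neumann eigenvalues for \<open>\<sigma> = 0\<close>).\<close>

definition desym_eigenvalue :: "real \<Rightarrow> nat \<Rightarrow> real" where
  "desym_eigenvalue \<sigma> =
     (THE lam. mono lam \<and>
        (\<exists>b. bij_betw b UNIV (desym_spectrum \<sigma>) \<and> (\<forall>n. lam n = snd (b n))))"

definition rn_gap :: "real \<Rightarrow> nat \<Rightarrow> real" where
  "rn_gap \<sigma> n = desym_eigenvalue \<sigma> n - desym_eigenvalue 0 n"

definition S :: "nat \<Rightarrow> real \<Rightarrow> real" where
  "S m \<nu> = 2 * tan (pi * (real m + \<nu>) / 2) *
     (Gamma ((\<nu> + real m) / 2 + 1) * Gamma ((\<nu> - real m) / 2 + 1)) /
     (Gamma ((\<nu> + real m + 1) / 2) * Gamma ((\<nu> - real m + 1) / 2))"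

definition nu :: "nat \<Rightarrow> nat \<Rightarrow> real \<Rightarrow> real" where
  "nu l m \<sigma> = (THE \<nu>. \<nu> \<in> {real l <..< real l + 1} \<and> S m \<nu> = \<sigma>)"

definition Lam :: "nat \<Rightarrow> nat \<Rightarrow> real \<Rightarrow> real" where
  "Lam l m \<sigma> = nu l m \<sigma> * (nu l m \<sigma> + 1)"

definition cluster :: "nat \<Rightarrow> real \<Rightarrow> real set" where
  "cluster l \<sigma> = {Lam l m \<sigma> | m. m \<le> l \<and> m mod 2 = l mod 2}"

end

theory Submission
  imports Defs "HOL-Real_Asymp.Real_Asymp"
begin

text \<open>Separating variables, an eigenfunction of sector \<open>m\<close> is
\<open>e\<^sup>i\<^sup>m\<^sup>\<phi> g(\<theta>)\<close> with \<open>g(\<theta>) = sin\<^sup>m \<theta> u(cos \<theta>)\<close>, where \<open>u\<close> solves the equation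
\<open>(1 - z\<^sup>2) u'' - 2 (m + 1) z u' + (\<mu> - m (m + 1)) u = 0\<close>. One solution, \<open>reg_sol\<close>, is analytic at the pole
\<open>z = 1\<close>; it is a hypergeometric series in \<open>(1 - z) / 2\<close> that converges for \<open>-1 < z < 3\<close>, so
\<open>(x + \<i> y)\<^sup>m u(z)\<close> is smooth near the closed hemisphere. Any other eigenfunction with the same \<open>m\<close> and \<open>\<mu>\<close> has, with
\<open>reg_sol\<close>, a Wronskian that is constant and tends to 0 at the pole. Hence \<open>\<mu>\<close> is an eigenvalue of sector \<open>m\<close> exactly when
\<open>reg_sol\<close> itself satisfies the boundary condition \<open>u'(0) = \<sigma> u(0)\<close> (\<open>sector_eigenvalue_iff\<close>).

The ratio \<open>u'(0) / u(0)\<close> has a closed form. Expand a solution at the equator into its even and odd parts; these are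
hypergeometric series in \<open>z\<^sup>2\<close> whose coefficients both grow like \<open>k\<^sup>m\<^sup>-\<^sup>1\<close>, with explicit Gamma factors. By Abel's
theorem both parts blow up at the pole at the same rate, so a bounded solution must make the combination of the two factors vanish
(\<open>bounded_polar_sol_connection\<close>). With the reflection formula this becomes the secular equation
\<open>2 G sin (\<pi> (\<nu> - m) / 2) = \<sigma> cos (\<pi> (\<nu> - m) / 2)\<close> for \<open>\<mu> = \<nu> (\<nu> + 1)\<close>, where
\<open>G = gamma_prod m \<nu>\<close> is positive and nondecreasing in \<open>\<nu>\<close>. Its roots are \<open>\<nu> = l\<close> for \<open>\<sigma> = 0\<close> and one root
\<open>nu l m \<sigma>\<close> in each interval \<open>(l, l + 1)\<close> for \<open>\<sigma> > 0\<close>, with \<open>l - m\<close> even and nonnegative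
(\<open>desym_spectrum_neumann\<close>, \<open>desym_spectrum_robin\<close>). Both spectra therefore put the same number of eigenvalues in every band
\<open>[l (l + 1), (l + 1) (l + 2))\<close>, so the sorted enumerations match band by band and the sum of the gaps over the \<open>l\<close>-th cluster is the sum over
\<open>m\<close> of \<open>Lam l m \<sigma> - l (l + 1)\<close> (\<open>sum_rn_gap\<close>).

For the asymptotics put \<open>\<delta> = nu l m \<sigma> - l\<close>. The secular equation gives \<open>2 G tan (\<pi> \<delta> / 2) = \<sigma>\<close>, and \<open>\<delta>\<close> tends to 0
uniformly in \<open>m\<close>, so \<open>\<delta>\<close> is \<open>\<sigma> / (\<pi> gamma_prod m l)\<close> up to a factor tending to 1 (\<open>nu_gap_bounds\<close>), and the gap is about
\<open>2 l \<delta>\<close>. The numbers \<open>1 / gamma_prod m l\<close> are \<open>\<pi>\<close> times products of two normalized central binomial coefficients, whose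
convolution is identically 1. So they add up to \<open>\<pi>\<close> over all \<open>m\<close> of either sign and to \<open>\<pi> / 2 + O(1 / l)\<close> over \<open>m \<ge> 0\<close>
(\<open>cluster_weight_bounds\<close>). Dividing \<open>2 l (\<sigma> / \<pi>) (\<pi> / 2) = \<sigma> l\<close> by the cluster size, about \<open>l / 2\<close>, gives \<open>2 \<sigma>\<close>.\<close>

section \<open>The hypergeometric series in terms of the sum and product of its parameters\<close>

text \<open>The coefficients of Gauss's series for parameters \<open>a\<close>, \<open>b\<close>, \<open>c\<close> with \<open>s = a + b\<close> and \<open>q = a b\<close>. For the Legendre equation
\<open>a\<close> and \<open>b\<close> are complex when the eigenvalue parameter is below \<open>-1/4\<close>, while \<open>s\<close> and \<open>q\<close> are always real.\<close>

primrec hyp_coeff :: "real \<Rightarrow> real \<Rightarrow> real \<Rightarrow> nat \<Rightarrow> real" where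
  "hyp_coeff q s c 0 = 1"
| "hyp_coeff q s c (Suc k) =
     ((real k)\<^sup>2 + s * real k + q) / ((c + real k) * (real k + 1)) * hyp_coeff q s c k"

declare hyp_coeff.simps(2) [simp del]

definition hyp :: "real \<Rightarrow> real \<Rightarrow> real \<Rightarrow> real \<Rightarrow> real" where
  "hyp q s c x = (\<Sum>k. hyp_coeff q s c k * x ^ k)"

definition hyp' :: "real \<Rightarrow> real \<Rightarrow> real \<Rightarrow> real \<Rightarrow> real" where
  "hyp' q s c x = (\<Sum>k. diffs (hyp_coeff q s c) k * x ^ k)"

definition hyp'' :: "real \<Rightarrow> real \<Rightarrow> real \<Rightarrow> real \<Rightarrow> real" where
  "hyp'' q s c x = (\<Sum>k. diffs (diffs (hyp_coeff q s c)) k * x ^ k)"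

lemma hyp_summable:
  assumes "\<bar>x\<bar> < 1"
  shows "summable (\<lambda>k. hyp_coeff q s c k * x ^ k)"
proof -
  let ?r = "\<lambda>k::nat. \<bar>((real k)\<^sup>2 + s * real k + q) / ((c + real k) * (real k + 1))\<bar> * \<bar>x\<bar>"
  have "(\<lambda>k::nat. ((real k)\<^sup>2 + s * real k + q) / ((c + real k) * (real k + 1))) \<longlonglongrightarrow> 1"
    by real_asymp
  then have "?r \<longlonglongrightarrow> \<bar>1\<bar> * \<bar>x\<bar>"
    by (intro tendsto_intros)
  moreover have "\<bar>1\<bar> * \<bar>x\<bar> < (1 + \<bar>x\<bar>) / 2"
    using assms by simp
  ultimately have "\<forall>\<^sub>F k in sequentially. ?r k < (1 + \<bar>x\<bar>) / 2"
    by (rule order_tendstoD(2))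
  then obtain N where N: "\<And>k. k \<ge> N \<Longrightarrow> ?r k < (1 + \<bar>x\<bar>) / 2"
    by (auto simp: eventually_sequentially)
  show ?thesis
  proof (rule summable_ratio_test)
    show "(1 + \<bar>x\<bar>) / 2 < 1" using assms by simp
    fix k assume "k \<ge> N"
    have "norm (hyp_coeff q s c (Suc k) * x ^ Suc k) = ?r k * norm (hyp_coeff q s c k * x ^ k)"
      by (simp add: hyp_coeff.simps abs_mult mult_ac)
    also have "\<dots> \<le> (1 + \<bar>x\<bar>) / 2 * norm (hyp_coeff q s c k * x ^ k)"
      using N[OF \<open>k \<ge> N\<close>] by (intro mult_right_mono) auto
    finally show "norm (hyp_coeff q s c (Suc k) * x ^ Suc k) \<le> \<dots>" .
  qed
qed

lemma hyp_summable':
  assumes "\<bar>x\<bar> < 1"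
  shows "summable (\<lambda>k. diffs (hyp_coeff q s c) k * x ^ k)"
  by (rule termdiff_converges[where K = 1]) (use assms hyp_summable in auto)

lemma hyp_summable'':
  assumes "\<bar>x\<bar> < 1"
  shows "summable (\<lambda>k. diffs (diffs (hyp_coeff q s c)) k * x ^ k)"
  by (rule termdiff_converges[where K = 1]) (use assms hyp_summable' in auto)

lemma hyp_deriv:
  assumes "\<bar>x\<bar> < 1"
  shows "(hyp q s c has_real_derivative hyp' q s c x) (at x)"
proof -
  have "((\<lambda>x. \<Sum>k. hyp_coeff q s c k * x ^ k) has_real_derivative
          (\<Sum>k. diffs (hyp_coeff q s c) k * x ^ k)) (at x)"
    using assms
    by (intro termdiffs_strong[where K = "(1 + \<bar>x\<bar>) / 2"] hyp_summable) (auto simp: abs_if)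
  then show ?thesis
    by (simp add: hyp_def[abs_def] hyp'_def)
qed

lemma hyp_deriv':
  assumes "\<bar>x\<bar> < 1"
  shows "(hyp' q s c has_real_derivative hyp'' q s c x) (at x)"
proof -
  have "((\<lambda>x. \<Sum>k. diffs (hyp_coeff q s c) k * x ^ k) has_real_derivative
          (\<Sum>k. diffs (diffs (hyp_coeff q s c)) k * x ^ k)) (at x)"
    using assms
    by (intro termdiffs_strong[where K = "(1 + \<bar>x\<bar>) / 2"] hyp_summable') (auto simp: abs_if)
  then show ?thesis
    by (simp add: hyp'_def[abs_def] hyp''_def)
qed

lemma continuous_hyp'':
  "continuous_on {-1<..<1} (hyp'' q s c)"
proof (rule continuous_at_imp_continuous_on, rule ballI)
  fix x :: real assume "x \<in> {-1<..<1}"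
  then have x: "\<bar>x\<bar> < 1" by auto
  have "((\<lambda>x. \<Sum>k. diffs (diffs (hyp_coeff q s c)) k * x ^ k) has_real_derivative
          (\<Sum>k. diffs (diffs (diffs (hyp_coeff q s c))) k * x ^ k)) (at x)"
    using x
    by (intro termdiffs_strong[where K = "(1 + \<bar>x\<bar>) / 2"] hyp_summable'') (auto simp: abs_if)
  then show "isCont (hyp'' q s c) x"
    using DERIV_isCont by (simp add: hyp''_def[abs_def]) blast
qed

lemma sums_shift:
  fixes f :: "nat \<Rightarrow> real"
  assumes "(\<lambda>k. f (Suc k)) sums l" "f 0 = 0"
  shows "f sums l"
  using sums_Suc[OF assms(1)] assms(2) by simp

text \<open>The recursion of the coefficients is Gauss's equation read off coefficientwise: \<open>x H'' + c H'\<close> shifts the index by one and produces the denominator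
\<open>(c + k) (k + 1)\<close>, whereas \<open>x\<^sup>2 H'' + (s + 1) x H' + q H\<close> produces the numerator \<open>k\<^sup>2 + s k + q\<close>.\<close>

lemma hyp_ode:
  assumes x: "\<bar>x\<bar> < 1" and c: "c > 0"
  shows "x * (1 - x) * hyp'' q s c x + (c - (s + 1) * x) * hyp' q s c x - q * hyp q s c x = 0"
proof -
  define a where "a = hyp_coeff q s c"
  have H: "(\<lambda>k. a k * x ^ k) sums hyp q s c x"
    using hyp_summable[OF x] by (simp add: hyp_def a_def summable_sums)
  have H1: "(\<lambda>k. (real k + 1) * a (Suc k) * x ^ k) sums hyp' q s c x"
    using hyp_summable'[OF x, of q s c]
    by (simp add: hyp'_def a_def diffs_def add_ac summable_sums)
  have H2: "(\<lambda>k. (real k + 1) * (real k + 2) * a (Suc (Suc k)) * x ^ k) sums hyp'' q s c x"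
    using summable_sums[OF hyp_summable''[OF x, of q s c]]
    by (simp add: hyp''_def a_def diffs_def algebra_simps)
  have xH1: "(\<lambda>k. real k * a k * x ^ k) sums (x * hyp' q s c x)"
  proof (rule sums_shift, goal_cases)
    case 1
    show ?case
      using sums_mult[OF H1, of x] by (simp add: algebra_simps)
  qed simp
  have xH2: "(\<lambda>k. real k * (real k + 1) * a (Suc k) * x ^ k) sums (x * hyp'' q s c x)"
  proof (rule sums_shift, goal_cases)
    case 1
    show ?case
      using sums_mult[OF H2, of x] by (simp add: algebra_simps)
  qed simp
  have xxH2: "(\<lambda>k. real k * (real k - 1) * a k * x ^ k) sums (x * (x * hyp'' q s c x))"
  proof (rule sums_shift, goal_cases)
    case 1
    show ?case
      using sums_mult[OF xH2, of x] by (simp add: algebra_simps)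
  qed simp
  have rec: "(c + real k) * (real k + 1) * a (Suc k) = ((real k)\<^sup>2 + s * real k + q) * a k" for k
    using c by (simp add: a_def hyp_coeff.simps add_pos_nonneg)
  have "(\<lambda>k. (c + real k) * (real k + 1) * a (Suc k) * x ^ k) sums (x * hyp'' q s c x + c * hyp' q s c x)"
    using sums_add[OF xH2 sums_mult[OF H1, of c]] by (simp add: algebra_simps)
  moreover have "(\<lambda>k. ((real k)\<^sup>2 + s * real k + q) * a k * x ^ k) sums
      (x * (x * hyp'' q s c x) + ((s + 1) * (x * hyp' q s c x) + q * hyp q s c x))"
    using sums_add[OF xxH2 sums_add[OF sums_mult[OF xH1, of "s + 1"] sums_mult[OF H, of q]]]
    by (simp add: algebra_simps power2_eq_square)
  ultimately have "x * hyp'' q s c x + c * hyp' q s c x =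
      x * (x * hyp'' q s c x) + ((s + 1) * (x * hyp' q s c x) + q * hyp q s c x)"
    unfolding rec by (rule sums_unique2)
  then show ?thesis by (simp add: algebra_simps)
qed

lemma hyp_0: "hyp q s c 0 = 1"
  by (simp add: hyp_def)

text \<open>Positivity of the coefficients is visible from \<open>q\<close>, \<open>s\<close> and \<open>c\<close> alone, whether or not the underlying \<open>a\<close> and \<open>b\<close> are real.\<close>

lemma hyp_pos:
  assumes "q > 0" "s \<ge> 0" "c > 0" "0 \<le> x" "x < 1"
  shows "hyp q s c x > 0" "hyp' q s c x > 0"
proof -
  have pos: "hyp_coeff q s c k > 0" for k
  proof (induction k)
    case (Suc k)
    have "(real k)\<^sup>2 + s * real k + q > 0" "(c + real k) * (real k + 1) > 0"
      using assms by (simp_all add: add_nonneg_pos mult_pos_pos add_pos_nonneg)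
    then show ?case
      using Suc by (simp add: hyp_coeff.simps)
  qed simp
  have "0 < hyp_coeff q s c 0 * x ^ 0" by simp
  also have "\<dots> \<le> (\<Sum>k. hyp_coeff q s c k * x ^ k)"
    using sum_le_suminf[OF hyp_summable[of x q s c], of "{0}"] pos assms
    by (auto simp: less_imp_le)
  finally show "hyp q s c x > 0" by (simp add: hyp_def)
  have "0 < diffs (hyp_coeff q s c) 0 * x ^ 0" using pos[of 1] by (simp add: diffs_def)
  also have "\<dots> \<le> (\<Sum>k. diffs (hyp_coeff q s c) k * x ^ k)"
    using sum_le_suminf[OF hyp_summable'[of x q s c], of "{0}"] pos assms
    by (auto simp: less_imp_le diffs_def)
  finally show "hyp' q s c x > 0" by (simp add: hyp'_def)
qed

lemma hyp_coeff_pochhammer: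
  assumes "s = a + b" "q = a * b"
  shows "hyp_coeff q s c k = pochhammer a k * pochhammer b k / (pochhammer c k * fact k)"
proof (induction k)
  case (Suc k)
  have "(real k)\<^sup>2 + s * real k + q = (a + real k) * (b + real k)"
    using assms by (simp add: algebra_simps power2_eq_square)
  then show ?case
    by (simp add: Suc hyp_coeff.simps pochhammer_Suc mult_ac)
qed simp

section \<open>The Legendre equation in the polar angle\<close>

definition legendre_sol ::
    "nat \<Rightarrow> real \<Rightarrow> (real \<Rightarrow> real) \<Rightarrow> (real \<Rightarrow> real) \<Rightarrow> (real \<Rightarrow> real) \<Rightarrow> real \<Rightarrow> bool" where
  "legendre_sol m \<mu> u u' u'' z \<longleftrightarrow>
     (u has_real_derivative u' z) (at z) \<and> (u' has_real_derivative u'' z) (at z) \<and>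
     (1 - z\<^sup>2) * u'' z - 2 * (real m + 1) * z * u' z + (\<mu> - real m * (real m + 1)) * u z = 0"

text \<open>The equation \<open>(sin t y')' = (m\<^sup>2 / sin t - \<mu> sin t) y\<close>, which is what the eigenvalue equation on the sphere says about the \<open>\<theta>\<close>-dependence in sector
\<open>m\<close>. Keeping the product \<open>sin t y'\<close> undifferentiated is what makes the Wronskian argument short.\<close>

definition polar_sol ::
    "nat \<Rightarrow> real \<Rightarrow> (real \<Rightarrow> real) \<Rightarrow> (real \<Rightarrow> real) \<Rightarrow> real \<Rightarrow> bool" where
  "polar_sol m \<mu> y y' t \<longleftrightarrow>
     (y has_real_derivative y' t) (at t) \<and>
     ((\<lambda>s. sin s * y' s) has_real_derivative ((real m)\<^sup>2 / sin t - \<mu> * sin t) * y t) (at t)"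

definition profile :: "nat \<Rightarrow> (real \<Rightarrow> real) \<Rightarrow> real \<Rightarrow> real" where
  "profile m u t = sin t ^ m * u (cos t)"

definition profile' :: "nat \<Rightarrow> (real \<Rightarrow> real) \<Rightarrow> (real \<Rightarrow> real) \<Rightarrow> real \<Rightarrow> real" where
  "profile' m u u' t = real m * sin t ^ (m - 1) * cos t * u (cos t) - sin t ^ (m + 1) * u' (cos t)"

lemma legendre_sol_imp_polar_sol:
  assumes "legendre_sol m \<mu> u u' u'' (cos t)" "sin t \<noteq> 0"
  shows "polar_sol m \<mu> (profile m u) (profile' m u u') t"
proof -
  have u: "(u has_real_derivative u' (cos t)) (at (cos t))"
    and u': "(u' has_real_derivative u'' (cos t)) (at (cos t))"
    and ode: "(1 - (cos t)\<^sup>2) * u'' (cos t) - 2 * (real m + 1) * cos t * u' (cos t) +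
                (\<mu> - real m * (real m + 1)) * u (cos t) = 0"
    using assms(1) by (auto simp: legendre_sol_def)
  have uc: "((\<lambda>s. u (cos s)) has_real_derivative - sin t * u' (cos t)) (at t)"
    using DERIV_chain2[OF u DERIV_cos] by (simp add: mult_ac)
  have uc': "((\<lambda>s. u' (cos s)) has_real_derivative - sin t * u'' (cos t)) (at t)"
    using DERIV_chain2[OF u' DERIV_cos] by (simp add: mult_ac)
  have 1: "(profile m u has_real_derivative profile' m u u' t) (at t)"
    unfolding profile_def[abs_def] profile'_def
    by (rule derivative_eq_intros uc refl)+ (simp add: algebra_simps)
  \<comment> \<open>multiplying by the sine absorbs the truncated exponent \<open>m - 1\<close>, so the case \<open>m = 0\<close> needs no separate treatment below\<close>
  have eq: "(\<lambda>s. sin s * profile' m u u' s) =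
      (\<lambda>s. real m * sin s ^ m * cos s * u (cos s) - sin s ^ (m + 2) * u' (cos s))"
    by (rule ext, cases m) (simp_all add: profile'_def algebra_simps)
  have p3: "sin t ^ (m + 3) = sin t * (sin t * (sin t * sin t ^ m))"
    by (simp add: power_add power3_eq_cube)
  have c2: "(cos t)\<^sup>2 = 1 - (sin t)\<^sup>2"
    by (simp add: cos_squared_eq)
  have "((\<lambda>s. real m * sin s ^ m * cos s * u (cos s) - sin s ^ (m + 2) * u' (cos s))
      has_real_derivative
        real m * (real m * sin t ^ (m - 1) * (cos t)\<^sup>2 - sin t ^ (m + 1)) * u (cos t)
        - real m * sin t ^ (m + 1) * cos t * u' (cos t)
        - ((real m + 2) * sin t ^ (m + 1) * cos t * u' (cos t)
        - sin t ^ (m + 3) * u'' (cos t))) (at t)"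
    by (rule derivative_eq_intros uc uc' refl)+ (simp add: p3 algebra_simps power2_eq_square)
  also have "real m * (real m * sin t ^ (m - 1) * (cos t)\<^sup>2 - sin t ^ (m + 1)) * u (cos t)
        - real m * sin t ^ (m + 1) * cos t * u' (cos t)
        - ((real m + 2) * sin t ^ (m + 1) * cos t * u' (cos t)
        - sin t ^ (m + 3) * u'' (cos t)) =
      sin t ^ (m + 1) * ((1 - (cos t)\<^sup>2) * u'' (cos t) - 2 * (real m + 1) * cos t * u' (cos t) +
                (\<mu> - real m * (real m + 1)) * u (cos t))
      + (real m * (real m * sin t ^ (m - 1))  - \<mu> * sin t ^ (m + 1)) * u (cos t)"
  proof -
    have "real m * sin t ^ (m + 1) = real m * sin t ^ (m - 1) * (sin t)\<^sup>2"
      by (cases m) (simp_all add: power2_eq_square)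
    moreover have "sin t ^ (m + 3) = sin t ^ (m + 1) * (sin t)\<^sup>2"
      by (simp add: p3 power2_eq_square)
    ultimately show ?thesis
      unfolding c2 by (auto simp: algebra_simps)
  qed
  also have "\<dots> = ((real m)\<^sup>2 / sin t - \<mu> * sin t) * profile m u t"
    unfolding ode using assms(2)
    by (cases m) (simp_all add: profile_def field_simps power2_eq_square)
  finally show ?thesis
    using 1 by (simp add: polar_sol_def eq)
qed

text \<open>The substitutions \<open>x = (1 - z) / 2\<close> and \<open>x = z\<^sup>2\<close> both turn the Legendre equation into Gauss's equation. The first gives the solution analytic at the pole, the
second the even and the odd solution at the equator.\<close>

definition reg_sol :: "nat \<Rightarrow> real \<Rightarrow> real \<Rightarrow> real" where
  "reg_sol m \<mu> z = hyp (real m * (real m + 1) - \<mu>) (2 * real m + 1) (real m + 1) ((1 - z) / 2)"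
definition reg_sol' :: "nat \<Rightarrow> real \<Rightarrow> real \<Rightarrow> real" where
  "reg_sol' m \<mu> z = - hyp' (real m * (real m + 1) - \<mu>) (2 * real m + 1) (real m + 1) ((1 - z) / 2) / 2"
definition reg_sol'' :: "nat \<Rightarrow> real \<Rightarrow> real \<Rightarrow> real" where
  "reg_sol'' m \<mu> z = hyp'' (real m * (real m + 1) - \<mu>) (2 * real m + 1) (real m + 1) ((1 - z) / 2) / 4"

definition even_sol :: "nat \<Rightarrow> real \<Rightarrow> real \<Rightarrow> real" where
  "even_sol m \<mu> z = hyp ((real m * (real m + 1) - \<mu>) / 4) (real m + 1/2) (1/2) (z\<^sup>2)"
definition even_sol' :: "nat \<Rightarrow> real \<Rightarrow> real \<Rightarrow> real" where
  "even_sol' m \<mu> z = 2 * z * hyp' ((real m * (real m + 1) - \<mu>) / 4) (real m + 1/2) (1/2) (z\<^sup>2)"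

definition odd_sol :: "nat \<Rightarrow> real \<Rightarrow> real \<Rightarrow> real" where
  "odd_sol m \<mu> z = z * hyp (((real m + 1) * (real m + 2) - \<mu>) / 4) (real m + 3/2) (3/2) (z\<^sup>2)"
definition odd_sol' :: "nat \<Rightarrow> real \<Rightarrow> real \<Rightarrow> real" where
  "odd_sol' m \<mu> z = hyp (((real m + 1) * (real m + 2) - \<mu>) / 4) (real m + 3/2) (3/2) (z\<^sup>2) +
      2 * z\<^sup>2 * hyp' (((real m + 1) * (real m + 2) - \<mu>) / 4) (real m + 3/2) (3/2) (z\<^sup>2)"

lemma legendre_sol_reg:
  assumes "-1 < z" "z < 3"
  shows "legendre_sol m \<mu> (reg_sol m \<mu>) (reg_sol' m \<mu>) (reg_sol'' m \<mu>) z"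
proof -
  define q s c where "q = real m * (real m + 1) - \<mu>" and "s = 2 * real m + 1" and "c = real m + 1"
  have R: "reg_sol m \<mu> = (\<lambda>z. hyp q s c ((1 - z) / 2))"
      "reg_sol' m \<mu> = (\<lambda>z. - hyp' q s c ((1 - z) / 2) / 2)"
      "reg_sol'' m \<mu> = (\<lambda>z. hyp'' q s c ((1 - z) / 2) / 4)"
    by (simp_all add: fun_eq_iff reg_sol_def reg_sol'_def reg_sol''_def q_def s_def c_def)
  have x: "\<bar>(1 - z) / 2\<bar> < 1" using assms by auto
  have inner: "((\<lambda>z::real. (1 - z) / 2) has_real_derivative - 1/2) (at z)"
    by (auto intro!: derivative_eq_intros)
  have "(reg_sol m \<mu> has_real_derivative reg_sol' m \<mu> z) (at z)"
    using DERIV_chain2[OF hyp_deriv[OF x, of q s c] inner]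
    by (simp add: R)
  moreover have "(reg_sol' m \<mu> has_real_derivative reg_sol'' m \<mu> z) (at z)"
    using DERIV_cdivide[OF DERIV_minus[OF DERIV_chain2[OF hyp_deriv'[OF x, of q s c] inner]], of 2]
    by (simp add: R)
  moreover have "(1 - z\<^sup>2) * reg_sol'' m \<mu> z - 2 * (real m + 1) * z * reg_sol' m \<mu> z +
      (\<mu> - real m * (real m + 1)) * reg_sol m \<mu> z = 0"
  proof -
    define X where "X = (1 - z) / 2"
    have z: "z = 1 - 2 * X" by (simp add: X_def field_simps)
    have alg: "(1 - (1 - 2 * X)\<^sup>2) * (H2 / 4) - 2 * (r + 1) * (1 - 2 * X) * (- H1 / 2) + (\<mu> - r * (r + 1)) * H =
        X * (1 - X) * H2 + ((r + 1) - ((2 * r + 1) + 1) * X) * H1 - (r * (r + 1) - \<mu>) * H" for r H H1 H2 :: real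
      by (simp add: field_simps power2_eq_square)
    have "X * (1 - X) * hyp'' q s c X + (c - (s + 1) * X) * hyp' q s c X - q * hyp q s c X = 0"
      using hyp_ode[OF x, of c q s] by (simp add: X_def c_def)
    then have "(1 - (1 - 2 * X)\<^sup>2) * (hyp'' q s c X / 4) - 2 * (real m + 1) * (1 - 2 * X) * (- hyp' q s c X / 2) +
        (\<mu> - real m * (real m + 1)) * hyp q s c X = 0"
      unfolding alg by (simp add: q_def s_def c_def)
    then show ?thesis
      unfolding R X_def[symmetric] z[symmetric] .
  qed
  ultimately show ?thesis by (simp add: legendre_sol_def)
qed

lemma legendre_sol_even:
  assumes "\<bar>z\<bar> < 1"
  obtains w where "legendre_sol m \<mu> (even_sol m \<mu>) (even_sol' m \<mu>) w z"
proof -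
  define q s c where "q = (real m * (real m + 1) - \<mu>) / 4" and "s = real m + 1/2" and "c = (1/2 :: real)"
  have R: "even_sol m \<mu> = (\<lambda>z. hyp q s c (z\<^sup>2))"
      "even_sol' m \<mu> = (\<lambda>z. 2 * z * hyp' q s c (z\<^sup>2))"
    by (simp_all add: fun_eq_iff even_sol_def even_sol'_def q_def s_def c_def)
  have x: "\<bar>z\<^sup>2\<bar> < 1" using assms by (simp add: abs_square_less_1)
  have inner: "((\<lambda>z::real. z\<^sup>2) has_real_derivative 2 * z) (at z)"
    by (auto intro!: derivative_eq_intros)
  have d: "((\<lambda>z. hyp q s c (z\<^sup>2)) has_real_derivative hyp' q s c (z\<^sup>2) * (2 * z)) (at z)"
    by (rule DERIV_chain2[OF hyp_deriv[OF x] inner])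
  have d': "((\<lambda>z. hyp' q s c (z\<^sup>2)) has_real_derivative hyp'' q s c (z\<^sup>2) * (2 * z)) (at z)"
    by (rule DERIV_chain2[OF hyp_deriv'[OF x] inner])
  let ?w = "\<lambda>z. 2 * hyp' q s c (z\<^sup>2) + 4 * z\<^sup>2 * hyp'' q s c (z\<^sup>2)"
  have "legendre_sol m \<mu> (even_sol m \<mu>) (even_sol' m \<mu>) ?w z"
    unfolding legendre_sol_def
  proof (intro conjI)
    show "(even_sol m \<mu> has_real_derivative even_sol' m \<mu> z) (at z)"
      using d by (simp add: R mult_ac)
    show "(even_sol' m \<mu> has_real_derivative ?w z) (at z)"
      unfolding R
      by (rule derivative_eq_intros d' refl)+ (simp add: power2_eq_square)
    have alg: "(1 - z\<^sup>2) * (2 * H1 + 4 * z\<^sup>2 * H2) - 2 * (r + 1) * z * (2 * z * H1) + (\<mu> - r * (r + 1)) * (H) =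
        4 * (z\<^sup>2 * (1 - z\<^sup>2) * H2 + (1/2 - (r + 1/2 + 1) * z\<^sup>2) * H1 - (r * (r + 1) - \<mu>) / 4 * H)" for r H H1 H2 :: real
      by (simp add: field_simps power2_eq_square power3_eq_cube)
    have "z\<^sup>2 * (1 - z\<^sup>2) * hyp'' q s c (z\<^sup>2) + (c - (s + 1) * z\<^sup>2) * hyp' q s c (z\<^sup>2) - q * hyp q s c (z\<^sup>2) = 0"
      using hyp_ode[OF x, of c q s] by (simp add: c_def)
    then show "(1 - z\<^sup>2) * ?w z - 2 * (real m + 1) * z * even_sol' m \<mu> z +
        (\<mu> - real m * (real m + 1)) * even_sol m \<mu> z = 0"
      unfolding R using alg[where r = "real m"]
      by (simp add: q_def s_def c_def)
  qed
  then show ?thesis by (rule that)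
qed

lemma legendre_sol_odd:
  assumes "\<bar>z\<bar> < 1"
  obtains w where "legendre_sol m \<mu> (odd_sol m \<mu>) (odd_sol' m \<mu>) w z"
proof -
  define q s c where "q = ((real m + 1) * (real m + 2) - \<mu>) / 4" and "s = real m + 3/2" and "c = (3/2 :: real)"
  have R: "odd_sol m \<mu> = (\<lambda>z. z * hyp q s c (z\<^sup>2))"
      "odd_sol' m \<mu> = (\<lambda>z. hyp q s c (z\<^sup>2) + 2 * z\<^sup>2 * hyp' q s c (z\<^sup>2))"
    by (simp_all add: fun_eq_iff odd_sol_def odd_sol'_def q_def s_def c_def)
  have x: "\<bar>z\<^sup>2\<bar> < 1" using assms by (simp add: abs_square_less_1)
  have inner: "((\<lambda>z::real. z\<^sup>2) has_real_derivative 2 * z) (at z)"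
    by (auto intro!: derivative_eq_intros)
  have d: "((\<lambda>z. hyp q s c (z\<^sup>2)) has_real_derivative hyp' q s c (z\<^sup>2) * (2 * z)) (at z)"
    by (rule DERIV_chain2[OF hyp_deriv[OF x] inner])
  have d': "((\<lambda>z. hyp' q s c (z\<^sup>2)) has_real_derivative hyp'' q s c (z\<^sup>2) * (2 * z)) (at z)"
    by (rule DERIV_chain2[OF hyp_deriv'[OF x] inner])
  let ?w = "\<lambda>z. 6 * z * hyp' q s c (z\<^sup>2) + 4 * z ^ 3 * hyp'' q s c (z\<^sup>2)"
  have "legendre_sol m \<mu> (odd_sol m \<mu>) (odd_sol' m \<mu>) ?w z"
    unfolding legendre_sol_def
  proof (intro conjI)
    show "(odd_sol m \<mu> has_real_derivative odd_sol' m \<mu> z) (at z)"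
      unfolding R
      by (rule derivative_eq_intros d refl)+ (simp add: power2_eq_square)
    show "(odd_sol' m \<mu> has_real_derivative ?w z) (at z)"
      unfolding R
      by (rule derivative_eq_intros d d' refl)+ (simp add: power2_eq_square power3_eq_cube)
    have alg: "(1 - z\<^sup>2) * (6 * z * H1 + 4 * z ^ 3 * H2) - 2 * (r + 1) * z * (H + 2 * z\<^sup>2 * H1) + (\<mu> - r * (r + 1)) * (z * H) =
        4 * z * (z\<^sup>2 * (1 - z\<^sup>2) * H2 + (3/2 - (r + 3/2 + 1) * z\<^sup>2) * H1 - ((r + 1) * (r + 2) - \<mu>) / 4 * H)" for r H H1 H2 :: real
      by (simp add: field_simps power2_eq_square power3_eq_cube)
    have "z\<^sup>2 * (1 - z\<^sup>2) * hyp'' q s c (z\<^sup>2) + (c - (s + 1) * z\<^sup>2) * hyp' q s c (z\<^sup>2) - q * hyp q s c (z\<^sup>2) = 0"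
      using hyp_ode[OF x, of c q s] by (simp add: c_def)
    then show "(1 - z\<^sup>2) * ?w z - 2 * (real m + 1) * z * odd_sol' m \<mu> z +
        (\<mu> - real m * (real m + 1)) * odd_sol m \<mu> z = 0"
      unfolding R using alg[where r = "real m"]
      by (simp add: q_def s_def c_def)
  qed
  then show ?thesis by (rule that)
qed

text \<open>The equation is self-adjoint, so \<open>sin t (y' z - y z')\<close> has derivative 0; its value is read off at the equator.\<close>

lemma wronskian_const:
  assumes y: "\<And>t. 0 < t \<Longrightarrow> t \<le> pi/2 \<Longrightarrow> polar_sol m \<mu> y y' t"
    and z: "\<And>t. 0 < t \<Longrightarrow> t \<le> pi/2 \<Longrightarrow> polar_sol m \<mu> z z' t"
    and t: "0 < t" "t \<le> pi/2"
  shows "sin t * (y' t * z t - y t * z' t) = y' (pi/2) * z (pi/2) - y (pi/2) * z' (pi/2)"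
proof -
  have "((\<lambda>t. sin t * y' t * z t - y t * (sin t * z' t)) has_field_derivative 0) (at t within {0<..pi/2})"
    if "t \<in> {0<..pi/2}" for t
  proof (rule DERIV_subset[of _ _ _ UNIV])
    have Y: "(y has_real_derivative y' t) (at t)"
        "((\<lambda>s. sin s * y' s) has_real_derivative ((real m)\<^sup>2 / sin t - \<mu> * sin t) * y t) (at t)"
      using y[of t] that by (auto simp: polar_sol_def)
    have Z: "(z has_real_derivative z' t) (at t)"
        "((\<lambda>s. sin s * z' s) has_real_derivative ((real m)\<^sup>2 / sin t - \<mu> * sin t) * z t) (at t)"
      using z[of t] that by (auto simp: polar_sol_def)
    show "((\<lambda>t. sin t * y' t * z t - y t * (sin t * z' t)) has_field_derivative 0) (at t)"
      by (rule derivative_eq_intros Y Z refl)+ (simp add: algebra_simps)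
  qed simp
  then obtain c where "\<And>t. t \<in> {0<..pi/2} \<Longrightarrow> sin t * y' t * z t - y t * (sin t * z' t) = c"
    using has_field_derivative_zero_constant[of "{0<..pi/2}" "\<lambda>t. sin t * y' t * z t - y t * (sin t * z' t)"]
    by auto
  from this[of t] this[of "pi/2"] show ?thesis
    using t by (simp add: algebra_simps)
qed

lemma cos_less_one:
  assumes "0 < t" "t \<le> pi/2"
  shows "0 \<le> cos t" "cos t < 1" "0 < sin t"
proof -
  show "0 \<le> cos t" using assms by (intro cos_ge_zero) auto
  show "0 < sin t" using assms by (intro sin_gt_zero) auto
  show "cos t < 1" using cos_monotone_0_pi[of 0 t] assms by simp
qed

lemma polar_sol_profile_even:
  "0 < t \<Longrightarrow> t \<le> pi/2 \<Longrightarrow> polar_sol m \<mu> (profile m (even_sol m \<mu>)) (profile' m (even_sol m \<mu>) (even_sol' m \<mu>)) t"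
  and polar_sol_profile_odd:
  "0 < t \<Longrightarrow> t \<le> pi/2 \<Longrightarrow> polar_sol m \<mu> (profile m (odd_sol m \<mu>)) (profile' m (odd_sol m \<mu>) (odd_sol' m \<mu>)) t"
  and polar_sol_profile_reg:
  "0 < t \<Longrightarrow> t \<le> pi/2 \<Longrightarrow> polar_sol m \<mu> (profile m (reg_sol m \<mu>)) (profile' m (reg_sol m \<mu>) (reg_sol' m \<mu>)) t"
proof -
  assume t: "0 < t" "t \<le> pi/2"
  note c = cos_less_one[OF t]
  have a: "\<bar>cos t\<bar> < 1" using c by auto
  show "polar_sol m \<mu> (profile m (even_sol m \<mu>)) (profile' m (even_sol m \<mu>) (even_sol' m \<mu>)) t"
    by (rule legendre_sol_even[OF a]) (use c in \<open>auto intro: legendre_sol_imp_polar_sol\<close>)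
  show "polar_sol m \<mu> (profile m (odd_sol m \<mu>)) (profile' m (odd_sol m \<mu>) (odd_sol' m \<mu>)) t"
    by (rule legendre_sol_odd[OF a]) (use c in \<open>auto intro: legendre_sol_imp_polar_sol\<close>)
  show "polar_sol m \<mu> (profile m (reg_sol m \<mu>)) (profile' m (reg_sol m \<mu>) (reg_sol' m \<mu>)) t"
    by (rule legendre_sol_imp_polar_sol[OF legendre_sol_reg]) (use c in auto)
qed

text \<open>This is uniqueness for the initial value problem at the equator. It needs no general existence theory: the three constant Wronskians of \<open>y\<close>, the even and the odd solution
determine \<open>y\<close> by linear algebra. The sign of the second term comes from \<open>d cos t / dt = -1\<close> at \<open>t = \<pi> / 2\<close>.\<close>

lemma polar_sol_eq_even_odd:
  assumes y: "\<And>t. 0 < t \<Longrightarrow> t \<le> pi/2 \<Longrightarrow> polar_sol m \<mu> y y' t"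
    and t: "0 < t" "t \<le> pi/2"
  shows "y t = y (pi/2) * profile m (even_sol m \<mu>) t - y' (pi/2) * profile m (odd_sol m \<mu>) t"
proof -
  let ?E = "profile m (even_sol m \<mu>)" and ?E' = "profile' m (even_sol m \<mu>) (even_sol' m \<mu>)"
  let ?O = "profile m (odd_sol m \<mu>)" and ?O' = "profile' m (odd_sol m \<mu>) (odd_sol' m \<mu>)"
  have init: "?E (pi/2) = 1" "?E' (pi/2) = 0" "?O (pi/2) = 0" "?O' (pi/2) = -1"
    by (simp_all add: profile_def profile'_def even_sol_def even_sol'_def odd_sol_def odd_sol'_def hyp_0)
  note E = polar_sol_profile_even[of _ m \<mu>] and O = polar_sol_profile_odd[of _ m \<mu>]
  have "sin t * (y' t * ?E t - y t * ?E' t) = y' (pi/2)"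
    using wronskian_const[OF y E t] init by simp
  moreover have "sin t * (y' t * ?O t - y t * ?O' t) = y (pi/2)"
    using wronskian_const[OF y O t] init by simp
  moreover have "sin t * (?E' t * ?O t - ?E t * ?O' t) = 1"
    using wronskian_const[OF E O t] init by simp
  moreover have "y t * (sin t * (?E' t * ?O t - ?E t * ?O' t)) =
      sin t * (y' t * ?O t - y t * ?O' t) * ?E t - sin t * (y' t * ?E t - y t * ?E' t) * ?O t"
    by (simp add: algebra_simps)
  ultimately show ?thesis by simp
qed

section \<open>The connection between equator and pole\<close>

text \<open>Abel's theorem in comparison form: the finitely many terms before \<open>a\<^sub>k / w\<^sub>k\<close> is close to \<open>\<alpha>\<close> contribute a bounded amount, which the divergence of the
comparison series makes negligible.\<close>

lemma abelian_ratio: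
  fixes a w :: "nat \<Rightarrow> real"
  assumes lim: "(\<lambda>k. a k / w k) \<longlonglongrightarrow> \<alpha>"
    and nonneg: "\<And>k. w k \<ge> 0" and pos: "\<forall>\<^sub>F k in sequentially. w k > 0"
    and sa: "\<And>x. 0 \<le> x \<Longrightarrow> x < 1 \<Longrightarrow> summable (\<lambda>k. a k * x ^ k)"
    and sw: "\<And>x. 0 \<le> x \<Longrightarrow> x < 1 \<Longrightarrow> summable (\<lambda>k. w k * x ^ k)"
    and div: "filterlim (\<lambda>x. \<Sum>k. w k * x ^ k) at_top (at_left 1)"
  shows "((\<lambda>x. (\<Sum>k. a k * x ^ k) / (\<Sum>k. w k * x ^ k)) \<longlongrightarrow> \<alpha>) (at_left 1)"
proof (rule tendstoI)
  fix e :: real assume e: "e > 0"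
  let ?A = "\<lambda>x. \<Sum>k. a k * x ^ k" and ?W = "\<lambda>x. \<Sum>k. w k * x ^ k"
  have "\<forall>\<^sub>F k in sequentially. \<bar>a k - \<alpha> * w k\<bar> \<le> e / 2 * w k"
    using tendstoD[OF lim half_gt_zero[OF e]] pos
  proof eventually_elim
    case (elim k)
    have "\<bar>a k - \<alpha> * w k\<bar> = \<bar>a k / w k - \<alpha>\<bar> * w k"
      using elim(2) by (simp add: field_simps abs_mult[symmetric])
    also have "\<dots> \<le> e / 2 * w k"
      using elim by (intro mult_right_mono) (auto simp: dist_real_def)
    finally show ?case .
  qed
  then obtain N where N: "\<And>k. k \<ge> N \<Longrightarrow> \<bar>a k - \<alpha> * w k\<bar> \<le> e / 2 * w k"
    by (auto simp: eventually_sequentially)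
  define M where "M = (\<Sum>k<N. \<bar>a k - \<alpha> * w k\<bar>)"
  have bound: "\<bar>?A x - \<alpha> * ?W x\<bar> \<le> M + e / 2 * ?W x" if x: "0 \<le> x" "x < 1" for x
  proof -
    let ?c = "\<lambda>k. if k < N then \<bar>a k - \<alpha> * w k\<bar> else 0"
    have c: "?c sums M"
      using sums_If_finite_set[of "{..<N}" "\<lambda>k. \<bar>a k - \<alpha> * w k\<bar>"] by (simp add: M_def)
    have le: "\<bar>(a k - \<alpha> * w k) * x ^ k\<bar> \<le> ?c k + e / 2 * (w k * x ^ k)" for k
    proof (cases "k < N")
      case True
      have "\<bar>(a k - \<alpha> * w k) * x ^ k\<bar> \<le> \<bar>a k - \<alpha> * w k\<bar> * 1"
        unfolding abs_mult using x by (intro mult_left_mono) (auto simp: power_le_one)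
      moreover have "0 \<le> e / 2 * (w k * x ^ k)" using e nonneg[of k] x by auto
      ultimately show ?thesis using True by simp
    next
      case False
      then show ?thesis
        using mult_right_mono[OF N[of k], of "x ^ k"] x by (simp add: abs_mult)
    qed
    have sum_diff: "(\<lambda>k. (a k - \<alpha> * w k) * x ^ k) sums (?A x - \<alpha> * ?W x)"
      using sums_diff[OF summable_sums[OF sa[OF x]] sums_mult[OF summable_sums[OF sw[OF x]], of \<alpha>]]
      by (simp add: algebra_simps)
    have sum_bd: "(\<lambda>k. ?c k + e / 2 * (w k * x ^ k)) sums (M + e / 2 * ?W x)"
      by (intro sums_add c sums_mult summable_sums[OF sw[OF x]])
    have "norm (suminf (\<lambda>k. (a k - \<alpha> * w k) * x ^ k)) \<le> (\<Sum>k. ?c k + e / 2 * (w k * x ^ k))"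
      using le by (intro norm_suminf_le sums_summable[OF sum_bd]) (simp add: abs_mult)
    then show ?thesis
      using sum_diff sum_bd by (simp add: sums_iff)
  qed
  have "\<forall>\<^sub>F x in at_left 1. ?W x > max 0 (2 * M / e)"
    using div by (simp add: filterlim_at_top_dense del: max_less_iff_conj)
  moreover have "\<forall>\<^sub>F x in at_left (1::real). 0 < x \<and> x < 1"
    using eventually_at_left_real[of 0 "1::real"] by simp
  ultimately show "\<forall>\<^sub>F x in at_left 1. dist (?A x / ?W x) \<alpha> < e"
  proof eventually_elim
    case (elim x)
    then have W: "?W x > 0" "M < e / 2 * ?W x" using e by (auto simp: field_simps)
    have "\<bar>?A x - \<alpha> * ?W x\<bar> < e * ?W x"
      using bound[of x] elim(2) W by (simp add: field_simps)
    moreover have "?A x / ?W x - \<alpha> = (?A x - \<alpha> * ?W x) / ?W x"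
      using W by (simp add: field_simps)
    ultimately show ?case
      using W by (simp add: dist_real_def pos_divide_less_eq)
  qed
qed

text \<open>Comparison coefficients of order \<open>k\<^sup>m\<^sup>-\<^sup>1\<close> with a generating function in closed form, \<open>(1 - x)\<^sup>-\<^sup>m\<close> for \<open>m \<ge> 1\<close> and \<open>- ln (1 - x)\<close> for
\<open>m = 0\<close>. In the latter case division by zero conveniently makes the coefficient at \<open>k = 0\<close> vanish.\<close>

definition pole_weight :: "nat \<Rightarrow> nat \<Rightarrow> real" where
  "pole_weight m k = (if m = 0 then 1 / real k else pochhammer (real m) k / fact k)"

lemma pole_weight_nonneg: "pole_weight m k \<ge> 0"
  by (auto simp: pole_weight_def pochhammer_nonneg)

lemma pole_weight_sums:
  assumes "0 \<le> x" "x < 1"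
  shows "(\<lambda>k. pole_weight m k * x ^ k) sums (if m = 0 then - ln (1 - x) else 1 / (1 - x) ^ m)"
proof (cases "m = 0")
  case True
  then show ?thesis
    using sums_minus[OF ln_series'[of "-x"]] assms by (simp add: pole_weight_def)
next
  case False
  have "(\<lambda>n. (- real m gchoose n) * (-x) ^ n) sums (1 + (-x)) powr (- real m)"
    using assms by (intro gen_binomial_real) auto
  moreover have "(- real m gchoose n) * (-x) ^ n = pole_weight m n * x ^ n" for n
  proof -
    have "(-1) ^ n * (-x) ^ n = x ^ n"
      by (simp flip: power_mult_distrib)
    then have "(-1) ^ n * (-x) ^ n * (pochhammer (real m) n / fact n) = x ^ n * (pochhammer (real m) n / fact n)"
      by (rule arg_cong)
    then show ?thesis
      using False by (simp add: gbinomial_pochhammer pole_weight_def mult_ac)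
  qed
  ultimately show ?thesis
    using False assms by (simp add: powr_minus powr_realpow field_simps)
qed

text \<open>From index 1 on the quotient is exactly a quotient of the sequences in Gauss's product formula for the reciprocal Gamma function: since
\<open>a + b = c + m\<close>, all powers of \<open>k\<close> cancel.\<close>

lemma pole_weight_limit:
  assumes "a + b = c + real m" "c > 0"
  shows "(\<lambda>k. hyp_coeff (a * b) (a + b) c k / pole_weight m k) \<longlonglongrightarrow>
      (if m = 0 then 1 else Gamma (real m)) * (rGamma a * rGamma b / rGamma c)"
proof -
  define \<kappa> where "\<kappa> = (if m = 0 then 1 else Gamma (real m))"
  have c0: "rGamma c \<noteq> 0"
    using Gamma_real_pos[OF \<open>c > 0\<close>] by (simp add: rGamma_inverse_Gamma)
  let ?R = "\<lambda>n. rGamma_series a n * rGamma_series b n / rGamma_series c n"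
  have R: "?R \<longlonglongrightarrow> rGamma a * rGamma b / rGamma c"
    by (intro tendsto_intros c0)
  have ser: "?R n = pochhammer a (n+1) * pochhammer b (n+1) / (pochhammer c (n+1) * fact n * exp (real m * ln (real n)))" for n
  proof -
    have "exp (a * ln (real n)) * exp (b * ln (real n)) = exp (c * ln (real n)) * exp (real m * ln (real n))"
      unfolding exp_add[symmetric] distrib_right[symmetric] assms(1) ..
    then show ?thesis
      by (simp add: rGamma_series_def field_simps)
  qed
  have "(\<lambda>n. hyp_coeff (a * b) (a + b) c (Suc n) / pole_weight m (Suc n)) \<longlonglongrightarrow> \<kappa> * (rGamma a * rGamma b / rGamma c)"
  proof (cases "m = 0")
    case True
    have "hyp_coeff (a * b) (a + b) c (Suc n) / pole_weight m (Suc n) = ?R n" for n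
      unfolding ser hyp_coeff_pochhammer[OF refl refl] using True
      by (simp add: pole_weight_def field_simps del: of_nat_Suc)
    then show ?thesis using R True by (simp add: \<kappa>_def)
  next
    case False
    have m0: "rGamma (real m) \<noteq> 0"
      using less_imp_neq[OF Gamma_real_pos[of "real m"]] False by (auto simp: rGamma_inverse_Gamma)
    have "hyp_coeff (a * b) (a + b) c (Suc n) / pole_weight m (Suc n) = ?R n / rGamma_series (real m) n" for n
      unfolding ser hyp_coeff_pochhammer[OF refl refl] using False
      by (simp add: pole_weight_def rGamma_series_def field_simps del: of_nat_Suc)
    moreover have "(\<lambda>n. ?R n / rGamma_series (real m) n) \<longlonglongrightarrow> (rGamma a * rGamma b / rGamma c) / rGamma (real m)"
      by (intro tendsto_divide R rGamma_series_LIMSEQ m0)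
    ultimately show ?thesis using False by (simp add: \<kappa>_def rGamma_inverse_Gamma field_simps)
  qed
  then show ?thesis
    unfolding \<kappa>_def by (rule LIMSEQ_imp_Suc)
qed

lemma pole_weight_suminf_at_top:
  "filterlim (\<lambda>x. \<Sum>k. pole_weight m k * x ^ k) at_top (at_left 1)"
proof -
  have "filterlim (\<lambda>x. if m = 0 then - ln (1 - x) else 1 / (1 - x) ^ m) at_top (at_left (1::real))"
  proof (cases "m = 0")
    case True
    have "filterlim (\<lambda>x::real. - ln (1 - x)) at_top (at_left 1)" by real_asymp
    then show ?thesis using True by simp
  next
    case False
    have "filterlim (\<lambda>x::real. 1 / (1 - x)) at_top (at_left 1)" by real_asymp
    then have "filterlim (\<lambda>x::real. (1 / (1 - x)) ^ m) at_top (at_left 1)"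
      using False by (intro filterlim_pow_at_top) auto
    then show ?thesis using False by (simp add: power_divide)
  qed
  moreover have "\<forall>\<^sub>F x in at_left (1::real). 0 < x \<and> x < 1"
    using eventually_at_left_real[of 0 "1::real"] by simp
  then have "\<forall>\<^sub>F x in at_left 1. (if m = 0 then - ln (1 - x) else 1 / (1 - x) ^ m) = (\<Sum>k. pole_weight m k * x ^ k)"
    by eventually_elim (rule sums_unique, rule pole_weight_sums, auto)
  ultimately show ?thesis
    by (simp add: filterlim_cong[OF refl refl])
qed

lemma hyp_over_pole_weight:
  assumes "a + b = c + real m" "c > 0" "q = a * b" "s = a + b"
  shows "((\<lambda>x. hyp q s c x / (\<Sum>k. pole_weight m k * x ^ k)) \<longlongrightarrow>
            (if m = 0 then 1 else Gamma (real m)) * (rGamma a * rGamma b / rGamma c)) (at_left 1)"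
proof -
  have lim: "(\<lambda>k. hyp_coeff q s c k / pole_weight m k) \<longlonglongrightarrow>
      (if m = 0 then 1 else Gamma (real m)) * (rGamma a * rGamma b / rGamma c)"
    using pole_weight_limit[OF assms(1,2)] by (simp only: assms(3,4))
  show ?thesis
    unfolding hyp_def
  proof (rule abelian_ratio[OF lim pole_weight_nonneg _ _ _ pole_weight_suminf_at_top])
    show "\<forall>\<^sub>F k in sequentially. pole_weight m k > 0"
      using eventually_gt_at_top[of 0]
      by eventually_elim (auto simp: pole_weight_def intro!: divide_pos_pos pochhammer_pos)
    show "summable (\<lambda>k. hyp_coeff q s c k * x ^ k)" if "0 \<le> x" "x < 1" for x
      using that by (intro hyp_summable) auto
    show "summable (\<lambda>k. pole_weight m k * x ^ k)" if "0 \<le> x" "x < 1" for x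
      using pole_weight_sums[OF that] by (rule sums_summable)
  qed
qed

text \<open>The comparison function outgrows even \<open>sin\<^sup>-\<^sup>m\<close>, so a polar solution of generic growth is unbounded: like \<open>sin\<^sup>-\<^sup>m\<close> for \<open>m \<ge> 1\<close> and
logarithmically for \<open>m = 0\<close>.\<close>

lemma sin_pow_pole_weight_at_top:
  "filterlim (\<lambda>t. sin t ^ m * (\<Sum>k. pole_weight m k * ((cos t)\<^sup>2) ^ k)) at_top (at_right 0)"
proof -
  have ev: "\<forall>\<^sub>F t in at_right (0::real). 0 < t \<and> t < pi/2"
    using eventually_at_right_real[of 0 "pi/2"] by simp
  have "\<forall>\<^sub>F t in at_right 0. (if m = 0 then - ln ((sin t)\<^sup>2) else 1 / sin t ^ m) =
      sin t ^ m * (\<Sum>k. pole_weight m k * ((cos t)\<^sup>2) ^ k)"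
    using ev
  proof eventually_elim
    case (elim t)
    then have c: "0 \<le> cos t" "cos t < 1" "0 < sin t" using cos_less_one[of t] by auto
    then have "(cos t)\<^sup>2 < 1" by (simp add: abs_square_less_1)
    then have "(\<Sum>k. pole_weight m k * ((cos t)\<^sup>2) ^ k) = (if m = 0 then - ln (1 - (cos t)\<^sup>2) else 1 / (1 - (cos t)\<^sup>2) ^ m)"
      using pole_weight_sums[of "(cos t)\<^sup>2" m] by (simp add: sums_iff)
    also have "1 - (cos t)\<^sup>2 = (sin t)\<^sup>2"
      by (simp add: sin_squared_eq)
    finally show ?case
      using c by (simp add: power2_eq_square power_mult_distrib)
  qed
  moreover have "filterlim (\<lambda>t. if m = 0 then - ln ((sin t)\<^sup>2) else 1 / sin t ^ m) at_top (at_right (0::real))"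
  proof (cases "m = 0")
    case True
    have "filterlim (\<lambda>t::real. - ln ((sin t)\<^sup>2)) at_top (at_right 0)" by real_asymp
    then show ?thesis using True by simp
  next
    case False
    have "filterlim (\<lambda>t::real. 1 / sin t) at_top (at_right 0)" by real_asymp
    then have "filterlim (\<lambda>t::real. (1 / sin t) ^ m) at_top (at_right 0)"
      using False by (intro filterlim_pow_at_top) auto
    then show ?thesis using False by (simp add: power_divide)
  qed
  ultimately show ?thesis
    by (simp add: filterlim_cong[OF refl refl])
qed

text \<open>Divide the expansion of \<open>y\<close> into even and odd part by the comparison function. The quotient tends to 0 at the pole because \<open>y\<close> is bounded, and the limits of the
two parts are their Gamma factors. The common positive factor \<open>\<Gamma>(1/2)\<close> (and \<open>\<Gamma>(m)\<close>) drops out, and \<open>\<Gamma>(3/2) = \<Gamma>(1/2) / 2\<close> accounts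
for the 2.\<close>

lemma bounded_polar_sol_connection:
  assumes y: "\<And>t. 0 < t \<Longrightarrow> t \<le> pi/2 \<Longrightarrow> polar_sol m (\<nu> * (\<nu> + 1)) y y' t"
    and bd: "\<And>t. 0 < t \<Longrightarrow> t \<le> pi/2 \<Longrightarrow> \<bar>y t\<bar> \<le> C"
  shows "2 * y (pi/2) * (rGamma ((real m - \<nu>) / 2) * rGamma ((real m + \<nu> + 1) / 2)) =
         y' (pi/2) * (rGamma ((real m - \<nu> + 1) / 2) * rGamma ((real m + \<nu>) / 2 + 1))"
proof -
  let ?W = "\<lambda>x. \<Sum>k. pole_weight m k * x ^ k"
  let ?g = "if m = 0 then 1 else Gamma (real m)"
  define U where "U = hyp ((real m * (real m + 1) - \<nu> * (\<nu> + 1)) / 4) (real m + 1/2) (1/2)"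
  define V where "V = hyp (((real m + 1) * (real m + 2) - \<nu> * (\<nu> + 1)) / 4) (real m + 3/2) (3/2)"
  define RU where "RU = rGamma ((real m - \<nu>) / 2) * rGamma ((real m + \<nu> + 1) / 2)"
  define RV where "RV = rGamma ((real m - \<nu> + 1) / 2) * rGamma ((real m + \<nu>) / 2 + 1)"
  have g: "?g > 0" by simp
  have limU: "((\<lambda>x. U x / ?W x) \<longlongrightarrow> ?g * (RU / rGamma (1/2))) (at_left 1)"
    unfolding U_def RU_def by (rule hyp_over_pole_weight) (simp_all add: field_simps)
  have limV: "((\<lambda>x. V x / ?W x) \<longlongrightarrow> ?g * (RV / rGamma (3/2))) (at_left 1)"
    unfolding V_def RV_def by (rule hyp_over_pole_weight) (simp_all add: field_simps)
  have ev: "\<forall>\<^sub>F t in at_right (0::real). 0 < t \<and> t < pi/2"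
    using eventually_at_right_real[of 0 "pi/2"] by simp
  have cos2: "filterlim (\<lambda>t::real. (cos t)\<^sup>2) (at_left 1) (at_right 0)"
    by real_asymp
  have cos1: "((\<lambda>t::real. cos t) \<longlongrightarrow> 1) (at_right 0)"
    by real_asymp
  let ?K = "\<lambda>t. sin t ^ m * ?W ((cos t)\<^sup>2)"
  have "((\<lambda>t. y (pi/2) * (U ((cos t)\<^sup>2) / ?W ((cos t)\<^sup>2)) - y' (pi/2) * (cos t * (V ((cos t)\<^sup>2) / ?W ((cos t)\<^sup>2))))
      \<longlongrightarrow> y (pi/2) * (?g * (RU / rGamma (1/2))) - y' (pi/2) * (1 * (?g * (RV / rGamma (3/2))))) (at_right 0)"
    by (intro tendsto_intros cos1 filterlim_compose[OF limU cos2] filterlim_compose[OF limV cos2])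
  moreover have "\<forall>\<^sub>F t in at_right 0.
      y (pi/2) * (U ((cos t)\<^sup>2) / ?W ((cos t)\<^sup>2)) - y' (pi/2) * (cos t * (V ((cos t)\<^sup>2) / ?W ((cos t)\<^sup>2))) = y t / ?K t"
    using ev
  proof eventually_elim
    case (elim t)
    then have t: "0 < t" "t \<le> pi/2" by auto
    have "sin t \<noteq> 0" using cos_less_one[OF t] by auto
    have "y t = y (pi/2) * (sin t ^ m * U ((cos t)\<^sup>2)) - y' (pi/2) * (sin t ^ m * (cos t * V ((cos t)\<^sup>2)))"
      using polar_sol_eq_even_odd[OF y t]
      by (simp add: profile_def even_sol_def odd_sol_def U_def V_def)
    also have "\<dots> = sin t ^ m * (y (pi/2) * U ((cos t)\<^sup>2) - y' (pi/2) * (cos t * V ((cos t)\<^sup>2)))"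
      by (simp add: algebra_simps)
    finally show ?case
      using \<open>sin t \<noteq> 0\<close> by (simp add: diff_divide_distrib)
  qed
  ultimately have 1: "((\<lambda>t. y t / ?K t) \<longlongrightarrow>
      y (pi/2) * (?g * (RU / rGamma (1/2))) - y' (pi/2) * (1 * (?g * (RV / rGamma (3/2))))) (at_right 0)"
    by (rule Lim_transform_eventually)
  have 2: "((\<lambda>t. y t / ?K t) \<longlongrightarrow> 0) (at_right 0)"
  proof (rule Lim_null_comparison)
    have "\<forall>\<^sub>F t in at_right 0. ?K t > 0"
      using sin_pow_pole_weight_at_top[of m] by (simp add: filterlim_at_top_dense)
    with ev show "\<forall>\<^sub>F t in at_right 0. norm (y t / ?K t) \<le> C / ?K t"
      by eventually_elim (use bd in \<open>auto intro!: divide_right_mono\<close>)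
    show "((\<lambda>t. C / ?K t) \<longlongrightarrow> 0) (at_right 0)"
      by (intro tendsto_divide_0[OF tendsto_const] filterlim_at_top_imp_at_infinity sin_pow_pole_weight_at_top)
  qed
  have "y (pi/2) * (?g * (RU / rGamma (1/2))) - y' (pi/2) * (1 * (?g * (RV / rGamma (3/2)))) = 0"
    by (rule tendsto_unique[OF _ 1 2]) simp
  then have "?g * (y (pi/2) * (RU / rGamma (1/2)) - y' (pi/2) * (RV / rGamma (3/2))) = 0"
    by (simp add: algebra_simps)
  then have eq: "y (pi/2) * (RU / rGamma (1/2)) = y' (pi/2) * (RV / rGamma (3/2))"
    using g by simp
  have "rGamma (3/2) = 2 * rGamma (1/2 :: real)"
    using rGamma_plus1[of "1/2::real"] by simp
  moreover have "rGamma (1/2 :: real) \<noteq> 0"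
    by (simp add: rGamma_inverse_Gamma Gamma_one_half_real)
  ultimately have "2 * y (pi/2) * RU = y' (pi/2) * RV"
    using eq by (simp add: field_simps)
  then show ?thesis unfolding RU_def RV_def .
qed

section \<open>Separated functions on the sphere\<close>

text \<open>Every derivative of the functions considered here is a combination of two fixed linear forms \<open>L\<close> and \<open>Z\<close> with complex coefficients. So the operator-valued derivatives
demanded by \<open>C2_on\<close> can be assembled from the scalar coefficients.\<close>

lemma C2_onI:
  fixes F c1 c2 c11 c12 c21 c22 :: "real^3 \<Rightarrow> complex" and L Z :: "real^3 \<Rightarrow> complex"
  assumes L: "bounded_linear L" and Z: "bounded_linear Z"
    and F: "\<And>x. x \<in> U \<Longrightarrow> (F has_derivative (\<lambda>v. c1 x * L v + c2 x * Z v)) (at x)"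
    and c1: "\<And>x. x \<in> U \<Longrightarrow> (c1 has_derivative (\<lambda>v. c11 x * L v + c12 x * Z v)) (at x)"
    and c2: "\<And>x. x \<in> U \<Longrightarrow> (c2 has_derivative (\<lambda>v. c21 x * L v + c22 x * Z v)) (at x)"
    and cont: "continuous_on U c11" "continuous_on U c12" "continuous_on U c21" "continuous_on U c22"
  shows "C2_on U F"
proof -
  define T :: "(real^3 \<Rightarrow> complex) \<Rightarrow> complex \<Rightarrow> ((real^3) \<Rightarrow>\<^sub>L complex)" where
    "T = (\<lambda>l c. blinfun_mult_right c o\<^sub>L Blinfun l)"
  have T: "bounded_linear (T l)" for l
    unfolding T_def
    by (rule bounded_linear_compose[OF bounded_bilinear.bounded_linear_left[OF bounded_bilinear_blinfun_compose]
          bounded_linear_blinfun_mult_right])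
  have TL: "blinfun_apply (T L c) = (\<lambda>v. c * L v)" and TZ: "blinfun_apply (T Z c) = (\<lambda>v. c * Z v)" for c
    by (simp_all add: T_def fun_eq_iff bounded_linear_Blinfun_apply L Z)
  define D where "D = (\<lambda>x. T L (c1 x) + T Z (c2 x))"
  define D2 where "D2 = (\<lambda>x. (Blinfun (T L) o\<^sub>L (T L (c11 x) + T Z (c12 x))) + (Blinfun (T Z) o\<^sub>L (T L (c21 x) + T Z (c22 x))))"
  have "(F has_derivative blinfun_apply (D x)) (at x)" if "x \<in> U" for x
    using F[OF that] by (simp add: D_def plus_blinfun.rep_eq TL TZ)
  moreover have "(D has_derivative blinfun_apply (D2 x)) (at x)" if "x \<in> U" for x
    using has_derivative_add[OF bounded_linear.has_derivative[OF T[of L] c1[OF that]]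
        bounded_linear.has_derivative[OF T[of Z] c2[OF that]]]
    by (simp add: D_def D2_def plus_blinfun.rep_eq TL TZ bounded_linear_Blinfun_apply[OF T])
  moreover have "continuous_on U D2"
    unfolding D2_def
    by (intro continuous_intros bounded_linear.continuous_on[OF T] cont
        bounded_linear.continuous_on[OF bounded_bilinear.bounded_linear_right[OF bounded_bilinear_blinfun_compose]])
  ultimately show ?thesis
    unfolding C2_on_def by blast
qed

text \<open>The two linear forms in which all derivatives of separated functions are expressed.\<close>

definition lin12 :: "real^3 \<Rightarrow> complex" where "lin12 p = Complex (p $ 1) (p $ 2)"
definition lin3 :: "real^3 \<Rightarrow> complex" where "lin3 p = of_real (p $ 3)"

lemma bounded_linear_lin3: "bounded_linear lin3"
  unfolding lin3_def by (rule bounded_linear_compose[OF bounded_linear_of_real bounded_linear_vec_nth])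

lemma bounded_linear_lin12: "bounded_linear lin12"
proof -
  have "bounded_linear (\<lambda>p :: real^3. of_real (p $ 1) + \<i> * of_real (p $ 2))"
    by (intro bounded_linear_add bounded_linear_const_mult
        bounded_linear_compose[OF bounded_linear_of_real bounded_linear_vec_nth])
  then show ?thesis
    by (simp add: lin12_def[abs_def] Complex_eq)
qed

lemma has_derivative_mode_factor:
  assumes "(h has_real_derivative h' ) (at (p $ 3))"
  shows "((\<lambda>p. k * lin12 p ^ n * of_real (h (p $ 3))) has_derivative
     (\<lambda>v. (k * (of_nat n * lin12 p ^ (n - 1)) * of_real (h (p $ 3))) * lin12 v +
          (k * lin12 p ^ n * of_real h') * lin3 v)) (at p)"
proof -
  have h: "((\<lambda>p. h (p $ 3)) has_derivative (\<lambda>v. h' * (v $ 3))) (at p)"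
    by (rule has_derivative_compose[where f = "\<lambda>p. p $ 3", OF _ assms[unfolded has_field_derivative_def]])
      (intro bounded_linear_imp_has_derivative bounded_linear_vec_nth)
  have "((\<lambda>p. k * lin12 p ^ n * of_real (h (p $ 3))) has_derivative
      (\<lambda>v. k * lin12 p ^ n * of_real (h' * (v $ 3)) +
           k * (of_nat n * lin12 v * lin12 p ^ (n - 1)) * of_real (h (p $ 3)))) (at p)"
    by (intro has_derivative_mult has_derivative_mult_right has_derivative_power
        bounded_linear_imp_has_derivative[OF bounded_linear_lin12]
        bounded_linear.has_derivative[OF bounded_linear_of_real h])
  then show ?thesis
    by (rule has_derivative_eq_rhs) (simp add: fun_eq_iff lin3_def algebra_simps)
qed

text \<open>The ambient form of the separated function \<open>e\<^sup>i\<^sup>m\<^sup>\<phi> sin\<^sup>m \<theta> h(cos \<theta>)\<close>: in Cartesian coordinates the pole is not singular.\<close>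

definition mode :: "nat \<Rightarrow> (real \<Rightarrow> real) \<Rightarrow> real^3 \<Rightarrow> complex" where
  "mode m h p = lin12 p ^ m * of_real (h (p $ 3))"

lemma mode_has_derivative:
  assumes "(h has_real_derivative h' (p $ 3)) (at (p $ 3))"
  shows "(mode m h has_derivative
     (\<lambda>v. (of_nat m * lin12 p ^ (m - 1) * of_real (h (p $ 3))) * lin12 v +
          (lin12 p ^ m * of_real (h' (p $ 3))) * lin3 v)) (at p)"
  using has_derivative_mode_factor[OF assms, of 1 m] by (simp add: mode_def[abs_def])

lemma C2_on_mode:
  assumes h: "\<And>z. z \<in> {a<..<b} \<Longrightarrow> (h has_real_derivative h' z) (at z)"
    and h': "\<And>z. z \<in> {a<..<b} \<Longrightarrow> (h' has_real_derivative h'' z) (at z)"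
    and h'': "continuous_on {a<..<b} h''"
  shows "C2_on {p. p $ 3 \<in> {a<..<b}} (mode m h)"
proof -
  let ?U = "{p :: real^3. p $ 3 \<in> {a<..<b}}"
  have c3: "continuous_on ?U (\<lambda>p. g (p $ 3))" if "continuous_on {a<..<b} g" for g :: "real \<Rightarrow> real"
    by (rule continuous_on_compose2[OF that]) (auto intro!: continuous_intros)
  have ch: "continuous_on {a<..<b} h" "continuous_on {a<..<b} h'"
    by (intro continuous_at_imp_continuous_on ballI, erule h[THEN DERIV_isCont] h'[THEN DERIV_isCont])+
  have cl: "continuous_on ?U lin12"
    by (rule bounded_linear.continuous_on[OF bounded_linear_lin12 continuous_on_id, simplified])
  show ?thesis
  proof (rule C2_onI[OF bounded_linear_lin12 bounded_linear_lin3])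
    show "(mode m h has_derivative (\<lambda>v. (of_nat m * lin12 p ^ (m - 1) * of_real (h (p $ 3))) * lin12 v +
          (lin12 p ^ m * of_real (h' (p $ 3))) * lin3 v)) (at p)" if "p \<in> ?U" for p
      using that by (intro mode_has_derivative h) auto
    show "((\<lambda>p. of_nat m * lin12 p ^ (m - 1) * of_real (h (p $ 3))) has_derivative
        (\<lambda>v. (of_nat m * (of_nat (m - 1) * lin12 p ^ (m - 1 - 1)) * of_real (h (p $ 3))) * lin12 v +
          (of_nat m * lin12 p ^ (m - 1) * of_real (h' (p $ 3))) * lin3 v)) (at p)" if "p \<in> ?U" for p
      using that by (intro has_derivative_mode_factor h) auto
    show "((\<lambda>p. lin12 p ^ m * of_real (h' (p $ 3))) has_derivative
        (\<lambda>v. (of_nat m * lin12 p ^ (m - 1) * of_real (h' (p $ 3))) * lin12 v +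
          (lin12 p ^ m * of_real (h'' (p $ 3))) * lin3 v)) (at p)" if "p \<in> ?U" for p
      using that has_derivative_mode_factor[OF h', of p 1 m] by auto
  qed (intro continuous_intros c3 ch h'' cl)+
qed

definition phase :: "nat \<Rightarrow> real \<Rightarrow> complex" where
  "phase m \<phi> = exp (\<i> * of_int (int m) * of_real \<phi>)"

lemma phase_nz: "phase m \<phi> \<noteq> 0" and phase_0: "phase m 0 = 1"
  by (simp_all add: phase_def)

lemma phase_eq_power: "phase m \<phi> = Complex (cos \<phi>) (sin \<phi>) ^ m"
proof -
  have "phase m \<phi> = exp (of_nat m * (\<i> * of_real \<phi>))"
    by (simp add: phase_def mult_ac)
  also have "\<dots> = exp (\<i> * of_real \<phi>) ^ m"
    by (rule exp_of_nat_mult)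
  also have "exp (\<i> * of_real \<phi>) = Complex (cos \<phi>) (sin \<phi>)"
    using cis_conv_exp[of \<phi>] by (simp add: cis.ctr)
  finally show ?thesis .
qed

lemma mode_sph: "mode m h (sph \<theta> \<phi>) = phase m \<phi> * of_real (profile m h \<theta>)"
proof -
  have "lin12 (sph \<theta> \<phi>) = of_real (sin \<theta>) * Complex (cos \<phi>) (sin \<phi>)"
    by (simp add: lin12_def sph_def complex_eq_iff)
  then show ?thesis
    by (simp add: mode_def profile_def sph_def phase_eq_power power_mult_distrib mult_ac)
qed

lemma phase_second_derivative:
  assumes "\<And>s. F s = phase m s * c"
  shows "vector_derivative (\<lambda>t. vector_derivative F (at t)) (at \<phi>) = - ((real m)\<^sup>2) *\<^sub>R F \<phi>"
proof -
  have E: "(phase m has_vector_derivative \<i> * of_nat m * phase m t) (at t)" for t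
  proof -
    have "((\<lambda>z. exp (\<i> * of_int (int m) * z)) has_field_derivative \<i> * of_nat m * exp (\<i> * of_int (int m) * of_real t)) (at (of_real t))"
      by (auto intro!: derivative_eq_intros)
    from has_vector_derivative_real_field[OF this] show ?thesis
      by (simp add: phase_def[abs_def])
  qed
  have F: "F = (\<lambda>s. phase m s * c)" using assms by auto
  have 1: "vector_derivative F (at t) = \<i> * of_nat m * c * phase m t" for t
    unfolding F
    by (rule vector_derivative_at, rule has_vector_derivative_eq_rhs, (rule derivative_intros E)+) simp
  have "vector_derivative (\<lambda>t. vector_derivative F (at t)) (at \<phi>) = \<i> * of_nat m * c * (\<i> * of_nat m * phase m \<phi>)"
    unfolding 1
    by (rule vector_derivative_at, rule has_vector_derivative_eq_rhs, (rule derivative_intros E)+) simp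
  also have "\<dots> = - ((real m)\<^sup>2) *\<^sub>R F \<phi>"
    by (simp add: F scaleR_conv_of_real power2_eq_square algebra_simps)
  finally show ?thesis .
qed

lemma laplace_beltrami_mode:
  assumes "\<And>t. 0 < t \<Longrightarrow> t < pi \<Longrightarrow> polar_sol m \<mu> (profile m h) g' t" and \<theta>: "0 < \<theta>" "\<theta> < pi"
  shows "laplace_beltrami (mode m h) \<theta> \<phi> + \<mu> *\<^sub>R mode m h (sph \<theta> \<phi>) = 0"
proof -
  have g: "(profile m h has_real_derivative g' t) (at t)"
      "((\<lambda>s. sin s * g' s) has_real_derivative ((real m)\<^sup>2 / sin t - \<mu> * sin t) * profile m h t) (at t)"
    if "0 < t" "t < pi" for t
    using assms(1)[OF that] by (auto simp: polar_sol_def)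
  have cplx: "((\<lambda>s. phase m \<phi> * of_real (k s)) has_vector_derivative phase m \<phi> * of_real k') (at t)"
    if "(k has_real_derivative k') (at t)" for k k' t
    using that
    by (intro has_vector_derivative_mult_right has_vector_derivative_of_real)
       (simp add: has_real_derivative_iff_has_vector_derivative)
  have 1: "vector_derivative (\<lambda>s. mode m h (sph s \<phi>)) (at t) = phase m \<phi> * of_real (g' t)"
    if "0 < t" "t < pi" for t
    unfolding mode_sph by (intro vector_derivative_at cplx g that)
  have "((\<lambda>t. sin t *\<^sub>R vector_derivative (\<lambda>s. mode m h (sph s \<phi>)) (at t)) has_vector_derivative
      phase m \<phi> * of_real (((real m)\<^sup>2 / sin \<theta> - \<mu> * sin \<theta>) * profile m h \<theta>)) (at \<theta>)"
    by (rule has_vector_derivative_transform_within_open[OF cplx[OF g(2)[OF \<theta>]], of "{0<..<pi}"])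
       (use \<theta> in \<open>auto simp: 1 scaleR_conv_of_real mult_ac\<close>)
  then have t: "vector_derivative (\<lambda>t. sin t *\<^sub>R vector_derivative (\<lambda>s. mode m h (sph s \<phi>)) (at t)) (at \<theta>) =
      phase m \<phi> * of_real (((real m)\<^sup>2 / sin \<theta> - \<mu> * sin \<theta>) * profile m h \<theta>)"
    by (rule vector_derivative_at)
  have p: "vector_derivative (\<lambda>t. vector_derivative (\<lambda>s. mode m h (sph \<theta> s)) (at t)) (at \<phi>) =
      - ((real m)\<^sup>2) *\<^sub>R mode m h (sph \<theta> \<phi>)"
    by (rule phase_second_derivative[where c = "of_real (profile m h \<theta>)"]) (rule mode_sph)
  have "sin \<theta> \<noteq> 0" using \<theta> sin_gt_zero[of \<theta>] by simp
  define r where "r = 1 / sin \<theta> * (((real m)\<^sup>2 / sin \<theta> - \<mu> * sin \<theta>) * profile m h \<theta>) +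
      1 / (sin \<theta>)\<^sup>2 * (- ((real m)\<^sup>2) * profile m h \<theta>) + \<mu> * profile m h \<theta>"
  have "laplace_beltrami (mode m h) \<theta> \<phi> + \<mu> *\<^sub>R mode m h (sph \<theta> \<phi>) = phase m \<phi> * of_real r"
    unfolding laplace_beltrami_def t p unfolding mode_sph
    by (simp add: r_def scaleR_conv_of_real algebra_simps)
  also have "r = 0"
    using \<open>sin \<theta> \<noteq> 0\<close> by (simp add: r_def field_simps power2_eq_square)
  finally show ?thesis by simp
qed

section \<open>Eigenvalues of a sector\<close>

lemma hemisphere_eq_sph: "hemisphere = {sph \<theta> \<phi> |\<theta> \<phi>. 0 \<le> \<theta> \<and> \<theta> \<le> pi/2}"
proof (intro subset_antisym subsetI)
  fix p assume "p \<in> hemisphere"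
  then have n: "(p $ 1)\<^sup>2 + (p $ 2)\<^sup>2 + (p $ 3)\<^sup>2 = 1" and "0 \<le> p $ 3"
    by (auto simp: hemisphere_def norm_vec_def L2_set_def sum_3)
  have z1: "p $ 3 \<le> 1"
  proof -
    have "(p $ 3)\<^sup>2 \<le> 1"
      using n zero_le_power2[of "p $ 1"] zero_le_power2[of "p $ 2"] by linarith
    then show ?thesis by (simp add: abs_square_le_1)
  qed
  define \<theta> where "\<theta> = arccos (p $ 3)"
  have \<theta>: "0 \<le> \<theta>" "\<theta> \<le> pi/2" "cos \<theta> = p $ 3"
    using \<open>0 \<le> p $ 3\<close> z1 arccos_le_pi2[of "p $ 3"] by (auto simp: \<theta>_def arccos_lbound)
  have s0: "0 \<le> sin \<theta>" using \<theta> by (intro sin_ge_zero) auto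
  have "cmod (Complex (p $ 1) (p $ 2)) = sqrt ((sin \<theta>)\<^sup>2)"
    using n by (simp add: cmod_def sin_squared_eq \<theta>(3) algebra_simps)
  then have "Complex (p $ 1) (p $ 2) = rcis (sin \<theta>) (Arg (Complex (p $ 1) (p $ 2)))"
    using s0 rcis_cmod_Arg[of "Complex (p $ 1) (p $ 2)"] by simp
  then obtain \<phi> where "p $ 1 = sin \<theta> * cos \<phi>" "p $ 2 = sin \<theta> * sin \<phi>"
    by (metis Re_rcis Im_rcis complex.sel)
  then have "p = sph \<theta> \<phi>"
    using \<theta>(3) by (simp add: sph_def vec_eq_iff forall_3)
  then show "p \<in> {sph \<theta> \<phi> |\<theta> \<phi>. 0 \<le> \<theta> \<and> \<theta> \<le> pi/2}" using \<theta> by blast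
next
  fix p assume "p \<in> {sph \<theta> \<phi> |\<theta> \<phi>. 0 \<le> \<theta> \<and> \<theta> \<le> pi/2}"
  then obtain \<theta> \<phi> where p: "p = sph \<theta> \<phi>" and "0 \<le> \<theta>" "\<theta> \<le> pi/2" by auto
  then have "0 \<le> cos \<theta>" by (intro cos_ge_zero) auto
  moreover have "(sin \<theta> * cos \<phi>)\<^sup>2 + (sin \<theta> * sin \<phi>)\<^sup>2 + (cos \<theta>)\<^sup>2 = 1"
    using sin_cos_squared_add[of \<phi>] sin_cos_squared_add[of \<theta>] by algebra
  ultimately show "p \<in> hemisphere"
    by (simp add: p hemisphere_def norm_vec_def L2_set_def sum_3 sph_def)
qed

lemma sph_in_hemisphere: "0 \<le> \<theta> \<Longrightarrow> \<theta> \<le> pi/2 \<Longrightarrow> sph \<theta> \<phi> \<in> hemisphere"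
  by (auto simp: hemisphere_eq_sph)

lemma profile_reg_at_equator:
  "profile m (reg_sol m \<mu>) (pi/2) = reg_sol m \<mu> 0"
  "profile' m (reg_sol m \<mu>) (reg_sol' m \<mu>) (pi/2) = - reg_sol' m \<mu> 0"
  by (simp_all add: profile_def profile'_def)

text \<open>Otherwise the solution would vanish identically up to the pole, where its value is 1.\<close>

lemma reg_sol_equator_nonzero: "reg_sol m \<mu> 0 \<noteq> 0 \<or> reg_sol' m \<mu> 0 \<noteq> 0"
proof (rule ccontr)
  assume "\<not> ?thesis"
  then have z: "reg_sol m \<mu> (cos t) = 0" if "0 < t" "t \<le> pi/2" for t
    using polar_sol_eq_even_odd[OF polar_sol_profile_reg that, of m \<mu>] cos_less_one[OF that]
    unfolding profile_reg_at_equator by (simp add: profile_def)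
  have "isCont (reg_sol m \<mu>) 1"
    using legendre_sol_reg[of 1 m \<mu>] by (auto simp: legendre_sol_def DERIV_isCont)
  then have "((\<lambda>t. reg_sol m \<mu> (cos t)) \<longlongrightarrow> reg_sol m \<mu> 1) (at_right 0)"
    by (rule isCont_tendsto_compose) (auto intro!: tendsto_eq_intros)
  moreover have "\<forall>\<^sub>F t in at_right 0. reg_sol m \<mu> (cos t) = 0"
    using eventually_at_right_real[of 0 "pi/2", simplified]
    by eventually_elim (use z in auto)
  ultimately have "((\<lambda>t::real. 0) \<longlongrightarrow> reg_sol m \<mu> 1) (at_right 0)"
    by (rule Lim_transform_eventually)
  then have "reg_sol m \<mu> 1 = 0"
    by (simp add: tendsto_const_iff)
  then show False by (simp add: reg_sol_def hyp_0)
qed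

lemma robin_solution_mode:
  assumes bc: "reg_sol' m \<mu> 0 = \<sigma> * reg_sol m \<mu> 0"
  shows "robin_solution \<sigma> \<mu> (mode m (reg_sol m \<mu>))"
  unfolding robin_solution_def
proof (intro conjI allI impI ballI)
  let ?F = "mode m (reg_sol m \<mu>)"
  have L: "(reg_sol m \<mu> has_real_derivative reg_sol' m \<mu> z) (at z)"
      "(reg_sol' m \<mu> has_real_derivative reg_sol'' m \<mu> z) (at z)" if "z \<in> {-1<..<3}" for z
    using legendre_sol_reg[of z m \<mu>] that by (auto simp: legendre_sol_def)
  have c: "continuous_on {-1<..<3} (reg_sol'' m \<mu>)"
    unfolding reg_sol''_def
    by (intro continuous_intros continuous_on_compose2[OF continuous_hyp'']) auto
  show "\<exists>U. open U \<and> hemisphere \<subseteq> U \<and> C2_on U ?F"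
  proof (intro exI conjI)
    show "C2_on {p. p $ 3 \<in> {-1<..<3}} ?F"
      by (rule C2_on_mode[OF L c])
    show "open {p :: real^3. p $ 3 \<in> {-1<..<3}}"
      by (intro open_vimage[unfolded vimage_def] continuous_intros open_greaterThanLessThan)
    show "hemisphere \<subseteq> {p. p $ 3 \<in> {-1<..<3}}"
    proof
      fix p assume "p \<in> hemisphere"
      then have "norm p = 1" "0 \<le> p $ 3" by (auto simp: hemisphere_def)
      moreover have "\<bar>p $ 3\<bar> \<le> norm p" by (rule component_le_norm_cart)
      ultimately show "p \<in> {p. p $ 3 \<in> {-1<..<3}}" by auto
    qed
  qed
  show "laplace_beltrami ?F \<theta> \<phi> + \<mu> *\<^sub>R ?F (sph \<theta> \<phi>) = 0" if "0 < \<theta> \<and> \<theta> \<le> pi/2" for \<theta> \<phi>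
  proof (rule laplace_beltrami_mode)
    fix t :: real assume t: "0 < t" "t < pi"
    have "sin t > 0" using t by (rule sin_gt_zero)
    moreover have "-1 < cos t"
      using cos_monotone_0_pi[of t pi] t by simp
    ultimately show "polar_sol m \<mu> (profile m (reg_sol m \<mu>)) (profile' m (reg_sol m \<mu>) (reg_sol' m \<mu>)) t"
      using cos_le_one[of t] by (intro legendre_sol_imp_polar_sol[OF legendre_sol_reg]) linarith+
  qed (use that pi_gt_zero in linarith)+
  show "frechet_derivative ?F (at p) (- axis 3 1) + \<sigma> *\<^sub>R ?F p = 0" if "p \<in> hemisphere" "p $ 3 = 0" for p
  proof -
    have "(?F has_derivative
     (\<lambda>v. (of_nat m * lin12 p ^ (m - 1) * of_real (reg_sol m \<mu> (p $ 3))) * lin12 v +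
          (lin12 p ^ m * of_real (reg_sol' m \<mu> (p $ 3))) * lin3 v)) (at p)"
      using that by (intro mode_has_derivative L) auto
    from frechet_derivative_at[OF this, symmetric]
    have "frechet_derivative ?F (at p) (- axis 3 1) = - (lin12 p ^ m * of_real (reg_sol' m \<mu> 0))"
      using that by (simp add: lin12_def lin3_def axis_def complex_eq_iff)
    then show ?thesis
      using that by (simp add: mode_def bc scaleR_conv_of_real mult_ac)
  qed
qed

text \<open>The eigenfunction is \<open>mode m (reg_sol m \<mu>)\<close>. It does not vanish on the equator: by the boundary condition, \<open>u(0) = 0\<close> would force \<open>u'(0) = 0\<close> too.\<close>

lemma sector_eigenvalue_mode:
  assumes bc: "reg_sol' m \<mu> 0 = \<sigma> * reg_sol m \<mu> 0"
  shows "sector_eigenvalue \<sigma> (int m) \<mu>"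
  unfolding sector_eigenvalue_def
proof (intro exI conjI)
  let ?F = "mode m (reg_sol m \<mu>)"
  show "robin_solution \<sigma> \<mu> ?F" by (rule robin_solution_mode[OF bc])
  show "in_sector (int m) ?F"
    unfolding in_sector_def
  proof (intro exI allI impI)
    fix \<theta> \<phi> :: real assume "0 \<le> \<theta> \<and> \<theta> \<le> pi/2"
    then have "sin \<theta> = sqrt (1 - (cos \<theta>)\<^sup>2)"
      by (intro sin_cos_sqrt sin_ge_zero) auto
    then show "?F (sph \<theta> \<phi>) = exp (\<i> * of_int (int m) * of_real \<phi>) *
        (\<lambda>z. of_real (sqrt (1 - z\<^sup>2) ^ m * reg_sol m \<mu> z)) (cos \<theta>)"
      by (simp add: mode_sph profile_def phase_def)
  qed
  have "reg_sol m \<mu> 0 \<noteq> 0"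
    using reg_sol_equator_nonzero[of m \<mu>] bc by auto
  then have "?F (sph (pi/2) 0) \<noteq> 0"
    by (simp add: mode_sph phase_nz profile_reg_at_equator)
  then show "\<exists>p\<in>hemisphere. ?F p \<noteq> 0"
    by (intro bexI[of _ "sph (pi/2) 0"] sph_in_hemisphere) auto
qed

text \<open>The Wronskian with the regular solution is constant, and it vanishes at the pole because of the factor \<open>sin t\<close>, everything else being bounded. At the equator it equals
\<open>y(\<pi>/2) (u'(0) - \<sigma> u(0))\<close>.\<close>

lemma bounded_polar_sol_robin:
  assumes y: "\<And>t. 0 < t \<Longrightarrow> t \<le> pi/2 \<Longrightarrow> polar_sol m \<mu> y y' t"
    and bd: "\<And>t. 0 < t \<Longrightarrow> t \<le> pi/2 \<Longrightarrow> \<bar>y t\<bar> \<le> C \<and> \<bar>y' t\<bar> \<le> C"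
    and bc: "y' (pi/2) = - \<sigma> * y (pi/2)"
    and nz: "0 < t0" "t0 \<le> pi/2" "y t0 \<noteq> 0"
  shows "reg_sol' m \<mu> 0 = \<sigma> * reg_sol m \<mu> 0"
proof -
  let ?R = "profile m (reg_sol m \<mu>)" and ?R' = "profile' m (reg_sol m \<mu>) (reg_sol' m \<mu>)"
  have y0: "y (pi/2) \<noteq> 0"
    using polar_sol_eq_even_odd[OF y nz(1,2)] nz(3) bc by auto
  have ev: "\<forall>\<^sub>F t in at_right (0::real). 0 < t \<and> t < pi/2"
    using eventually_at_right_real[of 0 "pi/2"] by simp
  have W: "sin t * (y' t * ?R t - y t * ?R' t) = y (pi/2) * (reg_sol' m \<mu> 0 - \<sigma> * reg_sol m \<mu> 0)"
    if "0 < t" "t \<le> pi/2" for t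
    using wronskian_const[OF y polar_sol_profile_reg that] unfolding profile_reg_at_equator bc
    by (simp add: algebra_simps)
  have cr: "isCont (reg_sol m \<mu>) 1" "isCont (reg_sol' m \<mu>) 1"
    using legendre_sol_reg[of 1 m \<mu>] by (auto simp: legendre_sol_def DERIV_isCont)
  have R: "isCont ?R 0" "isCont ?R' 0"
    unfolding profile_def profile'_def
    by (intro continuous_intros isCont_o2[OF isCont_cos] ; simp add: cr)+
  have "((\<lambda>t. sin t * (C * \<bar>?R t\<bar> + C * \<bar>?R' t\<bar>)) \<longlongrightarrow> sin 0 * (C * \<bar>?R 0\<bar> + C * \<bar>?R' 0\<bar>)) (at 0)"
    by (intro tendsto_intros R[unfolded isCont_def])
  then have lim: "((\<lambda>t. sin t * (C * \<bar>?R t\<bar> + C * \<bar>?R' t\<bar>)) \<longlongrightarrow> 0) (at_right 0)"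
    by (simp add: filterlim_at_split)
  have "((\<lambda>t. sin t * (y' t * ?R t - y t * ?R' t)) \<longlongrightarrow> 0) (at_right 0)"
  proof (rule Lim_null_comparison[OF _ lim], use ev in eventually_elim)
    case (elim t)
    then have t: "0 < t" "t \<le> pi/2" by auto
    have "\<bar>y' t * ?R t - y t * ?R' t\<bar> \<le> \<bar>y' t\<bar> * \<bar>?R t\<bar> + \<bar>y t\<bar> * \<bar>?R' t\<bar>"
      unfolding abs_mult[symmetric] by (rule abs_triangle_ineq4)
    also have "\<dots> \<le> C * \<bar>?R t\<bar> + C * \<bar>?R' t\<bar>"
      using bd[OF t] by (intro add_mono mult_right_mono) auto
    finally show ?case
      using cos_less_one(3)[OF t] by (simp add: abs_mult)
  qed
  moreover have "\<forall>\<^sub>F t in at_right 0. sin t * (y' t * ?R t - y t * ?R' t) = y (pi/2) * (reg_sol' m \<mu> 0 - \<sigma> * reg_sol m \<mu> 0)"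
    using ev by eventually_elim (rule W, auto)
  ultimately have "((\<lambda>t::real. y (pi/2) * (reg_sol' m \<mu> 0 - \<sigma> * reg_sol m \<mu> 0)) \<longlongrightarrow> 0) (at_right 0)"
    by (rule Lim_transform_eventually)
  then show ?thesis using y0 by (simp add: tendsto_const_iff)
qed

text \<open>Restrict the eigenfunction to the meridian \<open>\<phi> = 0\<close>. The restriction is \<open>C\<^sup>2\<close> up to both ends, hence bounded together with its derivative, and the
\<open>\<phi>\<close>-derivatives in the Laplacian are known from the sector condition. So its real and imaginary parts are real solutions of the polar equation, and one of them is not zero.\<close>

lemma sector_eigenvalue_imp_reg_sol:
  assumes "sector_eigenvalue \<sigma> (int m) \<mu>"
  shows "reg_sol' m \<mu> 0 = \<sigma> * reg_sol m \<mu> 0"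
proof -
  obtain F f U where rob: "robin_solution \<sigma> \<mu> F" and nz: "\<exists>p\<in>hemisphere. F p \<noteq> 0"
    and f: "\<And>\<theta> \<phi>. 0 \<le> \<theta> \<Longrightarrow> \<theta> \<le> pi/2 \<Longrightarrow> F (sph \<theta> \<phi>) = phase m \<phi> * f (cos \<theta>)"
    and U: "open U" "hemisphere \<subseteq> U" "C2_on U F"
    using assms unfolding sector_eigenvalue_def in_sector_def robin_solution_def phase_def by blast
  obtain D D2 where D: "\<And>x. x \<in> U \<Longrightarrow> (F has_derivative blinfun_apply (D x)) (at x)"
    and D2: "\<And>x. x \<in> U \<Longrightarrow> (D has_derivative blinfun_apply (D2 x)) (at x)"
    using U(3) unfolding C2_on_def by blast
  define c where "c t = sph t 0" for t
  define c' :: "real \<Rightarrow> real^3" where "c' t = cos t *\<^sub>R axis 1 1 - sin t *\<^sub>R axis 3 1" for t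
  have c_eq: "c = (\<lambda>t. sin t *\<^sub>R axis 1 1 + cos t *\<^sub>R axis 3 1)"
    by (simp add: c_def sph_def fun_eq_iff vec_eq_iff forall_3 axis_def)
  have c: "(c has_vector_derivative c' t) (at t)" for t
    unfolding c_eq c'_def has_vector_derivative_def
    by (auto intro!: derivative_eq_intros simp: fun_eq_iff algebra_simps)
  have c': "(c' has_vector_derivative - c t) (at t)" for t
    unfolding c_eq c'_def[abs_def] has_vector_derivative_def
    by (auto intro!: derivative_eq_intros simp: fun_eq_iff algebra_simps)
  have ccont: "continuous_on UNIV c" "continuous_on UNIV c'"
    unfolding c_eq c'_def[abs_def] by (intro continuous_intros)+
  \<comment> \<open>the meridian stays in \<open>U\<close> slightly beyond the equator, so two-sided derivatives exist at \<open>\<pi> / 2\<close>\<close>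
  define I where "I = c -` U"
  have I: "open I" unfolding I_def by (rule open_vimage[OF U(1) ccont(1)])
  have sub: "t \<in> I" if "0 \<le> t" "t \<le> pi/2" for t
    using U(2) sph_in_hemisphere[OF that] by (auto simp: I_def c_def)
  define G G' where "G t = F (c t)" and "G' t = blinfun_apply (D (c t)) (c' t)" for t
  have G: "(G has_vector_derivative G' t) (at t)" if "t \<in> I" for t
    using has_derivative_compose[OF c[unfolded has_vector_derivative_def] D[of "c t"]] that
    by (simp add: I_def G_def[abs_def] G'_def has_vector_derivative_def blinfun.scaleR_right)
  have G': "\<exists>K. (G' has_vector_derivative K) (at t)" if "t \<in> I" for t
  proof -
    have "((\<lambda>t. D (c t)) has_derivative (\<lambda>h. blinfun_apply (D2 (c t)) (h *\<^sub>R c' t))) (at t)"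
      using has_derivative_compose[OF c[unfolded has_vector_derivative_def] D2[of "c t"]] that
      by (simp add: I_def)
    then have "((\<lambda>t. D (c t)) has_vector_derivative blinfun_apply (D2 (c t)) (c' t)) (at t)"
      by (simp add: has_vector_derivative_def blinfun.scaleR_right)
    from bounded_bilinear.has_vector_derivative[OF bounded_bilinear_blinfun_apply this c']
    show ?thesis unfolding G'_def[abs_def] by blast
  qed
  have ode: "((\<lambda>t. sin t *\<^sub>R G' t) has_vector_derivative ((real m)\<^sup>2 / sin \<theta> - \<mu> * sin \<theta>) *\<^sub>R G \<theta>) (at \<theta>)"
    if \<theta>: "0 < \<theta>" "\<theta> \<le> pi/2" for \<theta>
  proof -
    have "\<theta> \<in> I" using sub that by auto
    obtain K0 where "(G' has_vector_derivative K0) (at \<theta>)" using G'[OF \<open>\<theta> \<in> I\<close>] by blast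
    then obtain K where K: "((\<lambda>t. sin t *\<^sub>R G' t) has_vector_derivative K) (at \<theta>)"
      using has_vector_derivative_scaleR[OF DERIV_sin] by blast
    have "((\<lambda>t. sin t *\<^sub>R vector_derivative (\<lambda>s. F (sph s 0)) (at t)) has_vector_derivative K) (at \<theta>)"
      by (rule has_vector_derivative_transform_within_open[OF K I \<open>\<theta> \<in> I\<close>])
         (use vector_derivative_at[OF G] in \<open>simp add: G_def[abs_def] c_def\<close>)
    then have 1: "vector_derivative (\<lambda>t. sin t *\<^sub>R vector_derivative (\<lambda>s. F (sph s 0)) (at t)) (at \<theta>) = K"
      by (rule vector_derivative_at)
    have 2: "vector_derivative (\<lambda>t. vector_derivative (\<lambda>s. F (sph \<theta> s)) (at t)) (at 0) =
        - ((real m)\<^sup>2) *\<^sub>R G \<theta>"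
      unfolding G_def c_def
      by (rule phase_second_derivative[where c = "f (cos \<theta>)"]) (use f that in auto)
    have eq: "laplace_beltrami F \<theta> 0 + \<mu> *\<^sub>R F (sph \<theta> 0) = 0"
      using rob \<theta> unfolding robin_solution_def by blast
    have s: "sin \<theta> \<noteq> 0" using cos_less_one[OF \<theta>] by simp
    have "(1 / sin \<theta>) *\<^sub>R K + (1 / (sin \<theta>)\<^sup>2) *\<^sub>R (- ((real m)\<^sup>2) *\<^sub>R G \<theta>) + \<mu> *\<^sub>R G \<theta> = 0"
      using eq unfolding laplace_beltrami_def 1 2 by (simp only: G_def c_def)
    then have "sin \<theta> *\<^sub>R ((1 / sin \<theta>) *\<^sub>R K + (1 / (sin \<theta>)\<^sup>2) *\<^sub>R (- ((real m)\<^sup>2) *\<^sub>R G \<theta>) + \<mu> *\<^sub>R G \<theta>) = 0"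
      by simp
    then have "K = ((real m)\<^sup>2 / sin \<theta> - \<mu> * sin \<theta>) *\<^sub>R G \<theta>"
      using s by (simp add: scaleR_add_right algebra_simps power2_eq_square)
    then show ?thesis using K by simp
  qed
  have bc: "G' (pi/2) = - \<sigma> *\<^sub>R G (pi/2)"
  proof -
    have p: "c (pi/2) \<in> hemisphere" unfolding c_def by (rule sph_in_hemisphere) auto
    have "frechet_derivative F (at (c (pi/2))) = blinfun_apply (D (c (pi/2)))"
      using frechet_derivative_at[OF D, of "c (pi/2)"] p U(2) by auto
    moreover have "c (pi/2) $ 3 = 0" by (simp add: c_def sph_def)
    moreover have "c' (pi/2) = - axis 3 1" by (simp add: c'_def)
    moreover have "frechet_derivative F (at q) (- axis 3 1) + \<sigma> *\<^sub>R F q = 0"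
      if "q \<in> hemisphere" "q $ 3 = 0" for q
      using rob that unfolding robin_solution_def by blast
    ultimately have "G' (pi/2) + \<sigma> *\<^sub>R G (pi/2) = 0"
      using p unfolding G'_def G_def by metis
    then show ?thesis
      by (simp add: eq_neg_iff_add_eq_0)
  qed
  have cont: "isCont G t" "isCont G' t" if "0 \<le> t" "t \<le> pi/2" for t
    using has_vector_derivative_continuous G[OF sub[OF that]] G'[OF sub[OF that]] by blast+
  have "compact (G ` {0..pi/2})" "compact (G' ` {0..pi/2})"
    by (intro compact_continuous_image continuous_at_imp_continuous_on compact_Icc ballI cont; simp)+
  then obtain B1 B2 where "\<And>t. 0 \<le> t \<Longrightarrow> t \<le> pi/2 \<Longrightarrow> norm (G t) \<le> B1"
      "\<And>t. 0 \<le> t \<Longrightarrow> t \<le> pi/2 \<Longrightarrow> norm (G' t) \<le> B2"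
    by (force dest!: compact_imp_bounded simp: bounded_iff)
  then obtain B where B: "norm (G t) \<le> B" "norm (G' t) \<le> B" if "0 < t" "t \<le> pi/2" for t
    by (metis less_imp_le max.coboundedI1 max.coboundedI2)
  have "\<exists>t0. 0 < t0 \<and> t0 \<le> pi/2 \<and> G t0 \<noteq> 0"
  proof (rule ccontr)
    assume "\<not> ?thesis"
    then have z: "G t = 0" if "0 < t" "t \<le> pi/2" for t using that by auto
    have "(G \<longlongrightarrow> G 0) (at_right 0)"
      using cont(1)[of 0] by (simp add: isCont_def filterlim_at_split)
    moreover have "\<forall>\<^sub>F t in at_right 0. G t = 0"
      using eventually_at_right_real[of 0 "pi/2", simplified]
      by eventually_elim (use z in auto)
    ultimately have "((\<lambda>t::real. 0) \<longlongrightarrow> G 0) (at_right 0)"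
      by (rule Lim_transform_eventually)
    then have "G 0 = 0" by (simp add: tendsto_const_iff)
    with z have z: "G t = 0" if "0 \<le> t" "t \<le> pi/2" for t using that by (cases "t = 0") auto
    have "F (sph \<theta> \<phi>) = 0" if "0 \<le> \<theta>" "\<theta> \<le> pi/2" for \<theta> \<phi>
      using z[OF that] f[OF that, of \<phi>] f[OF that, of 0] by (simp add: G_def c_def phase_0)
    with nz show False by (auto simp: hemisphere_eq_sph)
  qed
  then obtain t0 where t0: "0 < t0" "t0 \<le> pi/2" "G t0 \<noteq> 0" by blast
  have part: ?thesis if P: "bounded_linear P" and le: "\<And>z. \<bar>P z\<bar> \<le> norm z" and "P (G t0) \<noteq> 0" for P :: "complex \<Rightarrow> real"
  proof (rule bounded_polar_sol_robin[where y = "\<lambda>t. P (G t)" and y' = "\<lambda>t. P (G' t)", OF _ _ _ t0(1,2) \<open>P (G t0) \<noteq> 0\<close>])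
    fix t assume t: "0 < t" "t \<le> pi/2"
    have "((\<lambda>t. P (G t)) has_vector_derivative P (G' t)) (at t)"
      using bounded_linear.has_vector_derivative[OF P G] sub t by simp
    moreover have "((\<lambda>s. P (sin s *\<^sub>R G' s)) has_vector_derivative P (((real m)\<^sup>2 / sin t - \<mu> * sin t) *\<^sub>R G t)) (at t)"
      by (rule bounded_linear.has_vector_derivative[OF P ode[OF t]])
    ultimately show "polar_sol m \<mu> (\<lambda>t. P (G t)) (\<lambda>t. P (G' t)) t"
      using bounded_linear.linear[OF P]
      by (simp add: polar_sol_def has_real_derivative_iff_has_vector_derivative linear_scale)
    show "\<bar>P (G t)\<bar> \<le> B \<and> \<bar>P (G' t)\<bar> \<le> B"
      using B[OF t] le order_trans by blast
  next
    show "P (G' (pi/2)) = - \<sigma> * P (G (pi/2))"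
      using bounded_linear.linear[OF P] by (simp only: bc linear_scale) simp
  qed
  show ?thesis
  proof (cases "Re (G t0) = 0")
    case False
    then show ?thesis by (intro part[OF bounded_linear_Re abs_Re_le_cmod])
  next
    case True
    then have "Im (G t0) \<noteq> 0" using t0(3) by (simp add: complex_eq_iff)
    then show ?thesis by (intro part[OF bounded_linear_Im abs_Im_le_cmod])
  qed
qed

theorem sector_eigenvalue_iff:
  "sector_eigenvalue \<sigma> (int m) \<mu> \<longleftrightarrow> reg_sol' m \<mu> 0 = \<sigma> * reg_sol m \<mu> 0"
  using sector_eigenvalue_mode sector_eigenvalue_imp_reg_sol by blast

section \<open>The secular equation\<close>

lemma rGamma_reflection_real: "rGamma x * rGamma (1 - x :: real) = sin (pi * x) / pi"
proof -
  have "1 - complex_of_real x = complex_of_real (1 - x)" by simp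
  then have "complex_of_real (rGamma x * rGamma (1 - x)) = complex_of_real (sin (pi * x) / pi)"
    using rGamma_reflection_complex[of "of_real x"]
    by (simp only: rGamma_complex_of_real sin_of_real flip: of_real_mult of_real_divide)
  then show ?thesis by (simp only: of_real_eq_iff)
qed

lemma rGamma_eq_sin_Gamma:
  assumes "x < (1::real)"
  shows "rGamma x = sin (pi * x) / pi * Gamma (1 - x)"
proof -
  have "Gamma (1 - x) > 0" using assms by simp
  then have "rGamma (1 - x) * Gamma (1 - x) = 1" by (simp add: rGamma_inverse_Gamma)
  then have "rGamma x = rGamma x * rGamma (1 - x) * Gamma (1 - x)" by (simp add: mult.assoc)
  then show ?thesis by (simp only: rGamma_reflection_real)
qed

text \<open>The half-step quotient of the Gamma function, of size about \<open>sqrt x\<close>. Monotonicity together with the identity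
\<open>gamma_ratio x * gamma_ratio (x + 1/2) = x\<close> yields all the estimates of it that are needed, without Stirling's formula.\<close>

definition gamma_ratio :: "real \<Rightarrow> real" where
  "gamma_ratio x = Gamma (x + 1/2) / Gamma x"

lemma gamma_ratio_pos: "x > 0 \<Longrightarrow> gamma_ratio x > 0"
  by (simp add: gamma_ratio_def)

text \<open>The logarithmic derivative is a difference of two values of the increasing Digamma function.\<close>

lemma gamma_ratio_mono:
  assumes "0 < x" "x \<le> y"
  shows "gamma_ratio x \<le> gamma_ratio y"
proof -
  let ?f = "\<lambda>t. ln_Gamma (t + 1/2) - ln_Gamma t :: real"
  have "?f x \<le> ?f y"
  proof (rule DERIV_nonneg_imp_nondecreasing[OF \<open>x \<le> y\<close>])
    fix t assume "x \<le> t" "t \<le> y"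
    then have t: "t > 0" using \<open>0 < x\<close> by linarith
    then show "\<exists>D. (?f has_real_derivative D) (at t) \<and> 0 \<le> D"
      using Digamma_real_mono[of t "t + 1/2"]
      by (intro exI[of _ "Digamma (t + 1/2) - Digamma t"] conjI) (auto intro!: derivative_eq_intros)
  qed
  moreover have "gamma_ratio t = exp (?f t)" if "t > 0" for t
    using that by (simp add: gamma_ratio_def Gamma_real_pos_exp exp_diff)
  ultimately show ?thesis using assms by simp
qed

lemma gamma_ratio_mult_shift:
  assumes "x > 0"
  shows "gamma_ratio x * gamma_ratio (x + 1/2) = x"
proof -
  have "x \<notin> \<int>\<^sub>\<le>\<^sub>0" using assms by (auto elim!: nonpos_Ints_cases)
  then have "Gamma (x + 1) = x * Gamma x" by (rule Gamma_plus1)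
  moreover have "Gamma x > 0" "Gamma (x + 1/2) > 0" using assms by auto
  moreover have "x + 1/2 + 1/2 = x + 1" by simp
  ultimately show ?thesis unfolding gamma_ratio_def by (simp only:) simp
qed

lemma continuous_on_gamma_ratio: "continuous_on {0<..} gamma_ratio"
  unfolding gamma_ratio_def
proof (intro continuous_on_divide ballI)
  have no: "{0<..} \<inter> \<int>\<^sub>\<le>\<^sub>0 = ({} :: real set)" by (auto elim!: nonpos_Ints_cases)
  show "continuous_on {0::real<..} Gamma" by (rule continuous_on_Gamma[OF no])
  then show "continuous_on {0::real<..} (\<lambda>x. Gamma (x + 1/2))"
    by (rule continuous_on_compose2) (auto intro!: continuous_intros)
  show "Gamma x \<noteq> 0" if "x \<in> {0<..}" for x :: real
    using that less_imp_neq[OF Gamma_real_pos[of x]] by auto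
qed

definition gamma_prod :: "nat \<Rightarrow> real \<Rightarrow> real" where
  "gamma_prod m \<nu> = gamma_ratio ((\<nu> - real m + 1) / 2) * gamma_ratio ((\<nu> + real m + 1) / 2)"

lemma gamma_prod_pos: "real m \<le> \<nu> \<Longrightarrow> gamma_prod m \<nu> > 0"
  unfolding gamma_prod_def by (intro mult_pos_pos gamma_ratio_pos) auto

lemma gamma_prod_mono:
  assumes "real m \<le> \<nu>" "\<nu> \<le> \<nu>'"
  shows "gamma_prod m \<nu> \<le> gamma_prod m \<nu>'"
  unfolding gamma_prod_def using assms
  by (intro mult_mono gamma_ratio_mono less_imp_le[OF gamma_ratio_pos]) auto

lemma S_eq_tan_gamma_prod: "S m \<nu> = 2 * tan (pi * (real m + \<nu>) / 2) * gamma_prod m \<nu>"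
  by (simp add: S_def gamma_prod_def gamma_ratio_def field_simps)

text \<open>The regular solution is bounded on the hemisphere, so the connection formula applies to it. The reflection formula replaces the two reciprocal Gamma factors whose arguments
decrease with \<open>\<nu>\<close> by a sine and a cosine times Gamma factors with positive arguments.\<close>

lemma reg_sol_connection:
  assumes "real m \<le> \<nu>"
  defines "\<mu> \<equiv> \<nu> * (\<nu> + 1)"
  shows "reg_sol' m \<mu> 0 * cos (pi * (\<nu> - real m) / 2) =
         2 * gamma_prod m \<nu> * reg_sol m \<mu> 0 * sin (pi * (\<nu> - real m) / 2)"
proof -
  define A B where "A = reg_sol m \<mu> 0" and "B = reg_sol' m \<mu> 0"
  define d where "d = \<nu> - real m"
  have d: "d \<ge> 0" using assms by (simp add: d_def)
  have cont: "continuous_on {0..pi/2} (profile m (reg_sol m \<mu>))"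
  proof -
    have "isCont (reg_sol m \<mu>) z" if "z \<in> {0..1}" for z
      using legendre_sol_reg[of z m \<mu>] that by (auto simp: legendre_sol_def intro: DERIV_isCont)
    then have "continuous_on {0..1} (reg_sol m \<mu>)"
      by (intro continuous_at_imp_continuous_on ballI)
    then have "continuous_on {0..pi/2} (\<lambda>t. reg_sol m \<mu> (cos t))"
      by (rule continuous_on_compose2) (auto intro!: continuous_intros cos_ge_zero)
    then show ?thesis
      unfolding profile_def by (intro continuous_intros)
  qed
  then have "compact (profile m (reg_sol m \<mu>) ` {0..pi/2})"
    by (intro compact_continuous_image) auto
  then obtain C where C: "\<And>t. 0 < t \<Longrightarrow> t \<le> pi/2 \<Longrightarrow> \<bar>profile m (reg_sol m \<mu>) t\<bar> \<le> C"
    by (force dest!: compact_imp_bounded simp: bounded_iff)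
  have "2 * A * (rGamma ((real m - \<nu>) / 2) * rGamma ((real m + \<nu> + 1) / 2)) =
         - B * (rGamma ((real m - \<nu> + 1) / 2) * rGamma ((real m + \<nu>) / 2 + 1))"
    using bounded_polar_sol_connection[of m \<nu>, OF polar_sol_profile_reg C[unfolded \<mu>_def]]
    unfolding profile_reg_at_equator A_def B_def \<mu>_def by simp
  moreover have "(real m - \<nu>) / 2 = - (d / 2)" "(real m - \<nu> + 1) / 2 = 1/2 - d / 2"
    by (simp_all add: d_def field_simps)
  moreover have "rGamma (- (d / 2)) = - sin (pi * d / 2) / pi * Gamma (d / 2 + 1)"
    using rGamma_eq_sin_Gamma[of "- (d / 2)"] d by (simp add: add_ac)
  moreover have "rGamma (1/2 - d / 2) = cos (pi * d / 2) / pi * Gamma ((d + 1) / 2)"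
  proof -
    have "sin (pi * (1/2 - d / 2)) = cos (pi * d / 2)"
      by (simp add: cos_sin_eq algebra_simps)
    moreover have "1 - (1/2 - d/2) = (d + 1) / 2" by (simp add: field_simps)
    moreover have "1/2 - d / 2 < 1" using d by simp
    note rGamma_eq_sin_Gamma[OF this]
    ultimately show ?thesis by (simp only:)
  qed
  ultimately have eq: "2 * A * (- sin (pi * d / 2) / pi * Gamma (d / 2 + 1) * rGamma ((real m + \<nu> + 1) / 2)) =
      - B * (cos (pi * d / 2) / pi * Gamma ((d + 1) / 2) * rGamma ((real m + \<nu>) / 2 + 1))"
    by simp
  define g1 g2 g3 g4 where "g1 = Gamma (d / 2 + 1)" and "g2 = Gamma ((d + 1) / 2)"
    and "g3 = Gamma ((real m + \<nu> + 1) / 2)" and "g4 = Gamma ((real m + \<nu>) / 2 + 1)"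
  have pos: "g1 > 0" "g2 > 0" "g3 > 0" "g4 > 0"
    using d assms(1) by (auto simp: g1_def g2_def g3_def g4_def intro!: Gamma_real_pos add_nonneg_pos divide_nonneg_pos)
  have "d / 2 + 1 = (\<nu> - real m + 1) / 2 + 1/2" "(d + 1) / 2 = (\<nu> - real m + 1) / 2"
    "(real m + \<nu> + 1) / 2 = (\<nu> + real m + 1) / 2" "(real m + \<nu>) / 2 + 1 = (\<nu> + real m + 1) / 2 + 1/2"
    by (simp_all add: d_def field_simps)
  then have GG: "gamma_prod m \<nu> = g1 / g2 * (g4 / g3)"
    unfolding gamma_prod_def gamma_ratio_def g1_def g2_def g3_def g4_def by (simp only:)
  have "2 * A * (sin (pi * d / 2) * g1 / g3) = B * (cos (pi * d / 2) * g2 / g4)"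
    using arg_cong[OF eq, of "\<lambda>x. pi * x"] unfolding rGamma_inverse_Gamma g1_def[symmetric] g2_def[symmetric] g3_def[symmetric] g4_def[symmetric]
    by (simp add: field_simps)
  then show ?thesis
    using pos unfolding A_def[symmetric] B_def[symmetric] d_def[symmetric] GG by (simp add: field_simps)
qed

text \<open>The vectors \<open>(u(0), u'(0))\<close> and \<open>(cos, 2 G sin)\<close> are both nonzero and, by the connection formula, parallel. So one is proportional to
\<open>(1, \<sigma>)\<close> exactly when the other is.\<close>

lemma sector_eigenvalue_iff_secular:
  assumes "real m \<le> \<nu>"
  shows "sector_eigenvalue \<sigma> (int m) (\<nu> * (\<nu> + 1)) \<longleftrightarrow>
     2 * gamma_prod m \<nu> * sin (pi * (\<nu> - real m) / 2) = \<sigma> * cos (pi * (\<nu> - real m) / 2)"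
proof -
  define A B where "A = reg_sol m (\<nu> * (\<nu> + 1)) 0" and "B = reg_sol' m (\<nu> * (\<nu> + 1)) 0"
  define s c where "s = sin (pi * (\<nu> - real m) / 2)" and "c = cos (pi * (\<nu> - real m) / 2)"
  have AB: "B * c = 2 * gamma_prod m \<nu> * A * s"
    using reg_sol_connection[OF assms] by (simp add: A_def B_def s_def c_def)
  have nz: "A \<noteq> 0 \<or> B \<noteq> 0" unfolding A_def B_def by (rule reg_sol_equator_nonzero)
  have "s\<^sup>2 + c\<^sup>2 = 1" unfolding s_def c_def by (rule sin_cos_squared_add)
  then have sc: "s \<noteq> 0 \<or> c \<noteq> 0" by auto
  have "B = \<sigma> * A \<longleftrightarrow> 2 * gamma_prod m \<nu> * s = \<sigma> * c"
  proof
    assume "B = \<sigma> * A"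
    then show "2 * gamma_prod m \<nu> * s = \<sigma> * c" using AB nz by auto
  next
    assume *: "2 * gamma_prod m \<nu> * s = \<sigma> * c"
    then have "c \<noteq> 0" using sc gamma_prod_pos[OF assms] by auto
    moreover have "c * B = c * (\<sigma> * A)"
      using AB * by (simp add: mult_ac)
    ultimately show "B = \<sigma> * A" by simp
  qed
  then show ?thesis
    unfolding sector_eigenvalue_iff A_def B_def s_def c_def .
qed

text \<open>Below \<open>m (m + 1)\<close> the series of the regular solution has positive coefficients in \<open>(1 - z) / 2\<close>. Hence at the equator \<open>u > 0\<close> and \<open>u' < 0\<close>, which no
nonnegative \<open>\<sigma>\<close> allows.\<close>

lemma sector_eigenvalue_lower_bound:
  assumes "sector_eigenvalue \<sigma> (int m) \<mu>" "\<sigma> \<ge> 0"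
  shows "\<mu> \<ge> real m * (real m + 1)"
proof (rule ccontr)
  assume "\<not> ?thesis"
  then have "reg_sol m \<mu> 0 > 0" "reg_sol' m \<mu> 0 < 0"
    using hyp_pos[of "real m * (real m + 1) - \<mu>" "2 * real m + 1" "real m + 1" "1/2"]
    by (simp_all add: reg_sol_def reg_sol'_def)
  moreover have "reg_sol' m \<mu> 0 = \<sigma> * reg_sol m \<mu> 0"
    using assms(1) sector_eigenvalue_iff by blast
  ultimately show False using assms(2) by (simp add: mult_less_0_iff)
qed

lemma eq_mult_succ:
  assumes "\<mu> \<ge> real m * (real m + 1)"
  obtains \<nu> where "real m \<le> \<nu>" "\<mu> = \<nu> * (\<nu> + 1)"
proof -
  have "\<mu> \<ge> 0" using assms order_trans[of 0 "real m * (real m + 1)" \<mu>] by simp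
  \<comment> \<open>the larger root of \<open>\<nu> (\<nu> + 1) = \<mu>\<close>\<close>
  define \<nu> where "\<nu> = (sqrt (1 + 4 * \<mu>) - 1) / 2"
  have sq: "(2 * \<nu> + 1)\<^sup>2 = 1 + 4 * \<mu>" using \<open>\<mu> \<ge> 0\<close> by (simp add: \<nu>_def field_simps)
  then have mu: "\<mu> = \<nu> * (\<nu> + 1)" by (simp add: power2_eq_square algebra_simps)
  have "2 * real m + 1 = sqrt ((2 * real m + 1)\<^sup>2)" by simp
  also have "\<dots> \<le> sqrt (1 + 4 * \<mu>)"
    using assms by (intro real_sqrt_le_mono) (simp add: power2_eq_square algebra_simps)
  finally have "real m \<le> \<nu>" by (simp add: \<nu>_def field_simps)
  with mu show ?thesis using that by blast
qed

lemma sin_cos_shift: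
  assumes "l = m + 2 * k"
  shows "sin (pi * (\<nu> - real m) / 2) = (-1) ^ k * sin (pi * (\<nu> - real l) / 2)"
    and "cos (pi * (\<nu> - real m) / 2) = (-1) ^ k * cos (pi * (\<nu> - real l) / 2)"
proof -
  have *: "pi * (\<nu> - real m) / 2 = pi * (\<nu> - real l) / 2 + real k * pi"
    using assms by (simp add: field_simps)
  show "sin (pi * (\<nu> - real m) / 2) = (-1) ^ k * sin (pi * (\<nu> - real l) / 2)"
    and "cos (pi * (\<nu> - real m) / 2) = (-1) ^ k * cos (pi * (\<nu> - real l) / 2)"
    unfolding * sin_add cos_add by simp_all
qed

lemma mod2_eq_iff: "m \<le> l \<Longrightarrow> m mod 2 = l mod 2 \<longleftrightarrow> (\<exists>k. l = m + 2 * (k::nat))"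
  by presburger

text \<open>Removing the full periods of the secular equation puts \<open>\<nu> - l\<close> in \<open>[0, 2)\<close>. In the second half of that interval the sine is positive but the cosine is not, so the two
sides cannot agree.\<close>

lemma sector_eigenvalue_cell:
  assumes "real m \<le> \<nu>" "\<sigma> \<ge> 0" "sector_eigenvalue \<sigma> (int m) (\<nu> * (\<nu> + 1))"
  obtains l where "m \<le> l" "m mod 2 = l mod 2" "real l \<le> \<nu>" "\<nu> < real l + 1"
     "2 * gamma_prod m \<nu> * sin (pi * (\<nu> - real l) / 2) = \<sigma> * cos (pi * (\<nu> - real l) / 2)"
proof -
  define k where "k = nat \<lfloor>(\<nu> - real m) / 2\<rfloor>"
  \<comment> \<open>the number of full periods, so that \<open>l = m + 2 k\<close> is the largest index of the right parity with \<open>l \<le> \<nu>\<close>\<close>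
  have "real k = of_int \<lfloor>(\<nu> - real m) / 2\<rfloor>"
    using assms(1) by (simp add: k_def)
  then have k: "real k \<le> (\<nu> - real m) / 2" "(\<nu> - real m) / 2 < real k + 1"
    by linarith+
  define l where "l = m + 2 * k"
  have l: "m \<le> l" "m mod 2 = l mod 2" "real l \<le> \<nu>" "\<nu> < real l + 2"
    using k by (auto simp: l_def)
  have eq: "2 * gamma_prod m \<nu> * sin (pi * (\<nu> - real l) / 2) = \<sigma> * cos (pi * (\<nu> - real l) / 2)"
    using assms(3) unfolding sector_eigenvalue_iff_secular[OF assms(1)] sin_cos_shift[OF l_def]
    by (simp add: mult.left_commute[of _ "(-1) ^ k"] mult.assoc)
  have "\<nu> < real l + 1"
  proof (rule ccontr)
    assume "\<not> \<nu> < real l + 1"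
    then have "pi * 1 \<le> pi * (\<nu> - real l)" "pi * (\<nu> - real l) < pi * 2"
      using l by (auto intro!: mult_left_mono mult_strict_left_mono)
    then have x: "pi/2 \<le> pi * (\<nu> - real l) / 2" "pi * (\<nu> - real l) / 2 < pi"
      by simp_all
    have "sin (pi * (\<nu> - real l) / 2) > 0"
      using x pi_gt_zero by (intro sin_gt_zero) linarith+
    then have "0 < \<sigma> * cos (pi * (\<nu> - real l) / 2)"
      using eq gamma_prod_pos[OF assms(1)] by (metis mult_pos_pos zero_less_numeral)
    moreover have "cos (pi * (\<nu> - real l) / 2) \<le> 0"
      using x cos_monotone_0_pi_le[of "pi/2" "pi * (\<nu> - real l) / 2"] by simp
    ultimately show False using assms(2) by (simp add: zero_less_mult_iff)
  qed
  then show ?thesis using that l eq by blast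
qed

lemma S_in_cell:
  assumes "m \<le> l" "m mod 2 = l mod 2"
  shows "S m \<nu> = 2 * tan (pi * (\<nu> - real l) / 2) * gamma_prod m \<nu>"
proof -
  obtain k where k: "l = m + 2 * k" using assms mod2_eq_iff by blast
  have "pi * (real m + \<nu>) / 2 = pi * (\<nu> - real l) / 2 + real (m + k) * pi"
    using k by (simp add: field_simps)
  then show ?thesis unfolding S_eq_tan_gamma_prod by (simp only: tan_periodic_nat)
qed

lemma cell_angle:
  assumes "real l < \<nu>" "\<nu> < real l + 1"
  shows "0 < pi * (\<nu> - real l) / 2" "pi * (\<nu> - real l) / 2 < pi/2"
proof -
  show "0 < pi * (\<nu> - real l) / 2" using assms by simp
  have "pi * (\<nu> - real l) < pi * 1" using assms by (intro mult_strict_left_mono) auto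
  then show "pi * (\<nu> - real l) / 2 < pi/2" by simp
qed

lemma S_strict_mono_cell:
  assumes "m \<le> l" "m mod 2 = l mod 2" "real l < \<nu>" "\<nu> < \<nu>'" "\<nu>' < real l + 1"
  shows "S m \<nu> < S m \<nu>'"
proof -
  have "tan (pi * (\<nu> - real l) / 2) < tan (pi * (\<nu>' - real l) / 2)"
  proof (rule tan_monotone)
    show "- (pi/2) < pi * (\<nu> - real l) / 2"
      using cell_angle(1)[of l \<nu>] assms pi_gt_zero by linarith
    show "pi * (\<nu> - real l) / 2 < pi * (\<nu>' - real l) / 2"
      using assms by (intro divide_strict_right_mono mult_strict_left_mono) auto
    show "pi * (\<nu>' - real l) / 2 < pi/2"
      using cell_angle(2)[of l \<nu>'] assms by simp
  qed
  moreover have "0 < tan (pi * (\<nu> - real l) / 2)"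
    using cell_angle[of l \<nu>] assms by (intro tan_gt_zero) auto
  moreover have "0 < gamma_prod m \<nu>" "gamma_prod m \<nu> \<le> gamma_prod m \<nu>'"
    using assms by (auto intro!: gamma_prod_pos gamma_prod_mono)
  ultimately have "tan (pi * (\<nu> - real l) / 2) * gamma_prod m \<nu> < tan (pi * (\<nu>' - real l) / 2) * gamma_prod m \<nu>'"
    by (intro mult_less_le_imp_less) simp_all
  then show ?thesis
    unfolding S_in_cell[OF assms(1,2)] by simp
qed

lemma S_eq_iff_cell:
  assumes "m \<le> l" "m mod 2 = l mod 2" "real l < \<nu>" "\<nu> < real l + 1"
  shows "S m \<nu> = \<sigma> \<longleftrightarrow> 2 * gamma_prod m \<nu> * sin (pi * (\<nu> - real l) / 2) = \<sigma> * cos (pi * (\<nu> - real l) / 2)"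
proof -
  have "cos (pi * (\<nu> - real l) / 2) > 0"
    using cell_angle[of l \<nu>] assms by (intro cos_gt_zero) auto
  then show ?thesis
    unfolding S_in_cell[OF assms(1,2)] tan_def by (auto simp: field_simps)
qed

text \<open>The intermediate value theorem is applied to the secular equation cleared of its tangent, which is continuous on the closed interval: the left-hand side minus the right-hand
side is \<open>- \<sigma>\<close> at \<open>l\<close> and \<open>2 G\<close> at \<open>l + 1\<close>.\<close>

lemma S_root_exists:
  assumes ml: "m \<le> l" "m mod 2 = l mod 2" and "\<sigma> > 0"
  shows "\<exists>\<nu>. \<nu> \<in> {real l<..<real l + 1} \<and> S m \<nu> = \<sigma>"
proof -
  let ?\<phi> = "\<lambda>\<nu>. 2 * gamma_prod m \<nu> * sin (pi * (\<nu> - real l) / 2) - \<sigma> * cos (pi * (\<nu> - real l) / 2)"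
  have c: "continuous_on {real l..real l + 1} (gamma_prod m)"
    unfolding gamma_prod_def using ml
    by (intro continuous_intros continuous_on_compose2[OF continuous_on_gamma_ratio]) auto
  have "continuous_on {real l..real l + 1} ?\<phi>"
    by (intro continuous_intros c) auto
  moreover have lo: "?\<phi> (real l) < 0" using \<open>\<sigma> > 0\<close> by simp
  moreover have hi: "?\<phi> (real l + 1) > 0" using gamma_prod_pos[of m "real l + 1"] ml by simp
  ultimately obtain \<nu> where \<nu>: "real l \<le> \<nu>" "\<nu> \<le> real l + 1" "?\<phi> \<nu> = 0"
    using IVT'[of ?\<phi> "real l" 0 "real l + 1"] by auto
  then have "\<nu> \<noteq> real l" "\<nu> \<noteq> real l + 1" using lo hi by auto
  then have "real l < \<nu>" "\<nu> < real l + 1" using \<nu> by auto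
  with S_eq_iff_cell[OF ml this] \<nu>(3) show ?thesis by auto
qed

lemma nu_ex1:
  assumes ml: "m \<le> l" "m mod 2 = l mod 2" and "\<sigma> > 0"
  shows "\<exists>!\<nu>. \<nu> \<in> {real l<..<real l + 1} \<and> S m \<nu> = \<sigma>"
proof -
  have "\<nu> = \<nu>'" if "\<nu> \<in> {real l<..<real l + 1} \<and> S m \<nu> = \<sigma>" "\<nu>' \<in> {real l<..<real l + 1} \<and> S m \<nu>' = \<sigma>" for \<nu> \<nu>'
    using that S_strict_mono_cell[OF ml, of \<nu> \<nu>'] S_strict_mono_cell[OF ml, of \<nu>' \<nu>]
    by (cases \<nu> \<nu>' rule: linorder_cases) auto
  with S_root_exists[OF assms] show ?thesis by blast
qed

lemma nu_props:
  assumes "m \<le> l" "m mod 2 = l mod 2" "\<sigma> > 0"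
  shows "real l < nu l m \<sigma>" "nu l m \<sigma> < real l + 1" "S m (nu l m \<sigma>) = \<sigma>"
  using theI'[OF nu_ex1[OF assms]] unfolding nu_def by auto

lemma nu_unique:
  assumes "m \<le> l" "m mod 2 = l mod 2" "\<sigma> > 0" "real l < \<nu>" "\<nu> < real l + 1" "S m \<nu> = \<sigma>"
  shows "nu l m \<sigma> = \<nu>"
  using nu_ex1[OF assms(1-3)] nu_props[OF assms(1-3)] assms(4-6) by auto

theorem desym_spectrum_neumann:
  "desym_spectrum 0 = {(m, real l * (real l + 1)) | m l. m \<le> l \<and> m mod 2 = l mod 2}"
proof (intro subset_antisym subsetI)
  fix a assume "a \<in> desym_spectrum 0"
  then obtain m \<mu> where a: "a = (m, \<mu>)" and e: "sector_eigenvalue 0 (int m) \<mu>"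
    by (auto simp: desym_spectrum_def)
  obtain \<nu> where \<nu>: "real m \<le> \<nu>" "\<mu> = \<nu> * (\<nu> + 1)"
    using eq_mult_succ[OF sector_eigenvalue_lower_bound[OF e order_refl]] .
  obtain l where l: "m \<le> l" "m mod 2 = l mod 2" "real l \<le> \<nu>" "\<nu> < real l + 1"
     "2 * gamma_prod m \<nu> * sin (pi * (\<nu> - real l) / 2) = 0 * cos (pi * (\<nu> - real l) / 2)"
    using sector_eigenvalue_cell[OF \<nu>(1) order_refl e[unfolded \<nu>(2)]] .
  have "\<not> real l < \<nu>"
  proof
    assume "real l < \<nu>"
    then have "sin (pi * (\<nu> - real l) / 2) > 0"
      using cell_angle[of l \<nu>] l(4) by (intro sin_gt_zero) auto
    then show False using l(5) gamma_prod_pos[OF \<nu>(1)] by simp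
  qed
  then have "\<nu> = real l" using l by simp
  then show "a \<in> {(m, real l * (real l + 1)) | m l. m \<le> l \<and> m mod 2 = l mod 2}"
    using a \<nu> l by auto
next
  fix a assume "a \<in> {(m, real l * (real l + 1)) | m l. m \<le> l \<and> m mod 2 = l mod 2}"
  then obtain m l where a: "a = (m, real l * (real l + 1))" and l: "m \<le> l" "m mod 2 = l mod 2" by auto
  then obtain k where "l = m + 2 * k" using mod2_eq_iff by blast
  then have "sector_eigenvalue 0 (int m) (real l * (real l + 1))"
    using sector_eigenvalue_iff_secular[of m "real l" 0] by (simp add: sin_cos_shift)
  then show "a \<in> desym_spectrum 0" by (simp add: a desym_spectrum_def)
qed

theorem desym_spectrum_robin:
  assumes "\<sigma> > 0"
  shows "desym_spectrum \<sigma> = {(m, Lam l m \<sigma>) | m l. m \<le> l \<and> m mod 2 = l mod 2}"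
proof (intro subset_antisym subsetI)
  have \<sigma>0: "\<sigma> \<ge> 0" using assms by simp
  fix a assume "a \<in> desym_spectrum \<sigma>"
  then obtain m \<mu> where a: "a = (m, \<mu>)" and e: "sector_eigenvalue \<sigma> (int m) \<mu>"
    by (auto simp: desym_spectrum_def)
  obtain \<nu> where \<nu>: "real m \<le> \<nu>" "\<mu> = \<nu> * (\<nu> + 1)"
    using eq_mult_succ[OF sector_eigenvalue_lower_bound[OF e \<sigma>0]] .
  obtain l where l: "m \<le> l" "m mod 2 = l mod 2" "real l \<le> \<nu>" "\<nu> < real l + 1"
     "2 * gamma_prod m \<nu> * sin (pi * (\<nu> - real l) / 2) = \<sigma> * cos (pi * (\<nu> - real l) / 2)"
    using sector_eigenvalue_cell[OF \<nu>(1) \<sigma>0 e[unfolded \<nu>(2)]] .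
  have "\<nu> \<noteq> real l" using l(5) assms by auto
  then have "real l < \<nu>" using l(3) by simp
  moreover have "S m \<nu> = \<sigma>" using S_eq_iff_cell[OF l(1,2) \<open>real l < \<nu>\<close> l(4)] l(5) by simp
  ultimately have "nu l m \<sigma> = \<nu>" using nu_unique l assms by auto
  then show "a \<in> {(m, Lam l m \<sigma>) | m l. m \<le> l \<and> m mod 2 = l mod 2}"
    using a \<nu> l by (auto simp: Lam_def)
next
  fix a assume "a \<in> {(m, Lam l m \<sigma>) | m l. m \<le> l \<and> m mod 2 = l mod 2}"
  then obtain m l where a: "a = (m, Lam l m \<sigma>)" and l: "m \<le> l" "m mod 2 = l mod 2" by auto
  then obtain k where k: "l = m + 2 * k" using mod2_eq_iff by blast
  note nu = nu_props[OF l assms]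
  have "sector_eigenvalue \<sigma> (int m) (Lam l m \<sigma>)"
    unfolding Lam_def
  proof (subst sector_eigenvalue_iff_secular)
    show "real m \<le> nu l m \<sigma>" using nu l by simp
    have "2 * gamma_prod m (nu l m \<sigma>) * sin (pi * (nu l m \<sigma> - real l) / 2) = \<sigma> * cos (pi * (nu l m \<sigma> - real l) / 2)"
      using S_eq_iff_cell[OF l nu(1,2)] nu(3) by blast
    then show "2 * gamma_prod m (nu l m \<sigma>) * sin (pi * (nu l m \<sigma> - real m) / 2) = \<sigma> * cos (pi * (nu l m \<sigma> - real m) / 2)"
      unfolding sin_cos_shift[OF k] by (simp add: mult.left_commute[of _ "(-1) ^ k"] mult.assoc)
  qed
  then show "a \<in> desym_spectrum \<sigma>" by (simp add: a desym_spectrum_def)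
qed

section \<open>Sorted enumeration of a spectrum lying in bands\<close>

definition sorted_enum :: "(nat \<times> real) set \<Rightarrow> (nat \<Rightarrow> real) \<Rightarrow> bool" where
  "sorted_enum A lam \<longleftrightarrow> mono lam \<and> (\<exists>b. bij_betw b UNIV A \<and> (\<forall>n. lam n = snd (b n)))"

text \<open>Order \<open>A\<close> by value, breaking ties by sector. Every element then has finitely many predecessors, and counting them is a bijection onto the natural numbers; its inverse lists
\<open>A\<close> in order.\<close>

lemma sorted_enum_exists:
  fixes A :: "(nat \<times> real) set"
  assumes inf: "infinite A" and fin: "\<And>x. finite {a \<in> A. snd a < x}"
  shows "\<exists>lam. sorted_enum A lam"
proof -
  define lt where "lt a a' \<longleftrightarrow> snd a < snd a' \<or> (snd a = snd a' \<and> fst a < fst a')" for a a' :: "nat \<times> real"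
  define I where "I a = {a' \<in> A. lt a' a}" for a
  define r where "r a = card (I a)" for a
  have finI: "finite (I a)" for a
    by (rule finite_subset[OF _ fin[of "snd a + 1"]]) (auto simp: I_def lt_def)
  have mono: "r a < r a'" if "a \<in> A" "a' \<in> A" "lt a a'" for a a'
    unfolding r_def using that by (intro psubset_card_mono[OF finI]) (force simp: I_def lt_def)
  have lin: "a = a' \<or> lt a a' \<or> lt a' a" for a a'
    by (cases a; cases a') (auto simp: lt_def)
  have inj: "inj_on r A"
    using mono lin by (metis inj_onI less_irrefl)
  have seg: "{..<r a} \<subseteq> r ` A" if "a \<in> A" for a
  proof -
    have "r ` I a \<subseteq> {..<r a}" using mono[OF _ that] unfolding I_def by blast
    moreover have "card (r ` I a) = card {..<r a}"
      using inj by (subst card_image) (auto simp: r_def I_def intro: inj_on_subset)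
    ultimately have "r ` I a = {..<r a}" by (intro card_subset_eq) auto
    then show ?thesis by (auto simp: I_def)
  qed
  have "infinite (r ` A)" using inf inj finite_imageD by blast
  then have "r ` A = UNIV"
    using seg unfolding infinite_nat_iff_unbounded by blast
  with inj have bij: "bij_betw r A UNIV" by (simp add: bij_betw_def)
  define b where "b = inv_into A r"
  have b: "bij_betw b UNIV A" unfolding b_def by (rule bij_betw_inv_into[OF bij])
  have rb: "r (b n) = n" for n
    using bij by (simp add: b_def bij_betw_def f_inv_into_f)
  have bA: "b n \<in> A" for n using b by (auto simp: bij_betw_def)
  have "snd (b n) \<le> snd (b n')" if "n \<le> n'" for n n'
  proof (rule ccontr)
    assume "\<not> ?thesis"
    then have "r (b n') < r (b n)" by (intro mono bA) (simp add: lt_def)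
    then show False using that by (simp add: rb)
  qed
  then have "sorted_enum A (\<lambda>n. snd (b n))"
    unfolding sorted_enum_def using b by (auto intro!: monoI)
  then show ?thesis by blast
qed

text \<open>Monotonicity makes the indices with value below \<open>x\<close> an initial segment, whose length is the number of elements of \<open>A\<close> below \<open>x\<close>. So the enumeration is
determined by these counts.\<close>

lemma sorted_enum_less_iff:
  assumes "sorted_enum A lam" "finite {a \<in> A. snd a < x}"
  shows "lam n < x \<longleftrightarrow> n < card {a \<in> A. snd a < x}"
proof -
  obtain b where "mono lam" and b: "bij_betw b UNIV A" and lam: "\<And>n. lam n = snd (b n)"
    using assms(1) by (auto simp: sorted_enum_def)
  let ?N = "{n. lam n < x}"
  have "bij_betw b ?N {a \<in> A. snd a < x}"
    by (rule bij_betw_subset[OF b]) (use b lam in \<open>auto simp: bij_betw_def\<close>)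
  then have c: "card ?N = card {a \<in> A. snd a < x}" and f: "finite ?N"
    using assms(2) by (auto simp: bij_betw_same_card bij_betw_finite)
  have down: "k \<in> ?N" if "n \<in> ?N" "k \<le> n" for k n
    using that monoD[OF \<open>mono lam\<close>, of k n] by auto
  have "?N = {..<card ?N}"
  proof (rule card_subset_eq[symmetric, OF f])
    show "card {..<card ?N} = card ?N" by simp
    show "{..<card ?N} \<subseteq> ?N"
    proof (rule ccontr)
      assume "\<not> ?thesis"
      then obtain k where k: "k < card ?N" "k \<notin> ?N" by auto
      then have "?N \<subseteq> {..<k}" using down by (metis lessThan_iff not_le subsetI)
      then have "card ?N \<le> k" using card_mono[of "{..<k}" ?N] by simp
      then show False using k by simp
    qed
  qed
  then show ?thesis using c by auto
qed

lemma sorted_enum_unique: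
  assumes "sorted_enum A lam" "sorted_enum A lam'" "\<And>x. finite {a \<in> A. snd a < x}"
  shows "lam = lam'"
proof
  fix n
  have "lam n < x \<longleftrightarrow> lam' n < x" for x
    using sorted_enum_less_iff[OF assms(1,3)] sorted_enum_less_iff[OF assms(2,3)] by simp
  then show "lam n = lam' n" by (metis less_irrefl linorder_neqE)
qed

definition cells :: "nat \<Rightarrow> nat set" where
  "cells l = {m. m \<le> l \<and> m mod 2 = l mod 2}"

text \<open>The common shape of the Neumann and the Robin spectrum: one eigenvalue \<open>E l m\<close> for each \<open>l\<close> and each sector \<open>m \<in> cells l\<close>.\<close>

definition levels :: "(nat \<Rightarrow> nat \<Rightarrow> real) \<Rightarrow> (nat \<times> real) set" where
  "levels E = {(m, E l m) | m l. m \<in> cells l}"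

text \<open>The \<open>l\<close>-th level lies in the band from one Neumann eigenvalue to the next. The Neumann levels sit at the lower edges, so these edges are included.\<close>

definition banded :: "(nat \<Rightarrow> nat \<Rightarrow> real) \<Rightarrow> bool" where
  "banded E \<longleftrightarrow> (\<forall>l. \<forall>m\<in>cells l. real l * (real l + 1) \<le> E l m \<and> E l m < real (Suc l) * (real (Suc l) + 1))"

lemma finite_cells [simp]: "finite (cells l)"
  by (rule finite_subset[of _ "{..l}"]) (auto simp: cells_def)

lemma band_edge_mono: "j \<le> k \<Longrightarrow> real j * (real j + 1) \<le> real k * (real k + 1)"
  by (intro mult_mono) auto

lemma band_less_iff:
  assumes "banded E" "m \<in> cells l"
  shows "E l m < real k * (real k + 1) \<longleftrightarrow> l < k"
proof
  assume "l < k"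
  then show "E l m < real k * (real k + 1)"
    using assms band_edge_mono[of "Suc l" k] by (force simp: banded_def)
next
  assume "E l m < real k * (real k + 1)"
  then show "l < k"
    using assms band_edge_mono[of k l] by (force simp: banded_def not_le)
qed

lemma levels_below:
  assumes "banded E"
  shows "{a \<in> levels E. snd a < real k * (real k + 1)} = (\<lambda>(j, m). (m, E j m)) ` (SIGMA j:{..<k}. cells j)"
proof -
  have "{a \<in> levels E. snd a < real k * (real k + 1)} = {(m, E l m) | m l. m \<in> cells l \<and> l < k}"
    unfolding levels_def using band_less_iff[OF assms] by fastforce
  also have "\<dots> = (\<lambda>(j, m). (m, E j m)) ` (SIGMA j:{..<k}. cells j)"
    by (auto simp: image_iff)
  finally show ?thesis .
qed

lemma level_inj:
  assumes "banded E" "m \<in> cells l" "m \<in> cells j" "E l m = E j m"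
  shows "l = j"
proof -
  have "j < Suc l"
    using band_less_iff[OF assms(1,2), of "Suc l"] band_less_iff[OF assms(1,3), of "Suc l"] assms(4) by simp
  moreover have "l < Suc j"
    using band_less_iff[OF assms(1,2), of "Suc j"] band_less_iff[OF assms(1,3), of "Suc j"] assms(4) by simp
  ultimately show ?thesis by simp
qed

lemma card_levels_below:
  assumes "banded E"
  shows "card {a \<in> levels E. snd a < real k * (real k + 1)} = (\<Sum>j<k. card (cells j))"
proof -
  have "inj_on (\<lambda>(j, m). (m, E j m)) (SIGMA j:{..<k}. cells j)"
    using level_inj[OF assms] by (auto simp: inj_on_def)
  then show ?thesis
    unfolding levels_below[OF assms] by (simp add: card_image)
qed

lemma finite_levels_below:
  assumes "banded E"
  shows "finite {a \<in> levels E. snd a < x}"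
proof -
  obtain k where "x \<le> real k" using real_arch_simple by blast
  then have "x \<le> real k * (real k + 1)"
    using zero_le_square[of "real k"] unfolding distrib_left by linarith
  then have "{a \<in> levels E. snd a < x} \<subseteq> {a \<in> levels E. snd a < real k * (real k + 1)}" by auto
  moreover have "finite {a \<in> levels E. snd a < real k * (real k + 1)}"
    unfolding levels_below[OF assms] by auto
  ultimately show ?thesis by (rule finite_subset)
qed

lemma infinite_levels: "infinite (levels E)"
proof -
  have "inj (\<lambda>l. (l, E l l))" by (auto simp: inj_on_def)
  then have "infinite (range (\<lambda>l. (l, E l l)))" by (rule range_inj_infinite)
  moreover have "range (\<lambda>l. (l, E l l)) \<subseteq> levels E" by (auto simp: levels_def cells_def)
  ultimately show ?thesis using finite_subset by blast
qed

lemma sorted_enum_desym_eigenvalue: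
  assumes "desym_spectrum \<sigma> = levels E" "banded E"
  shows "sorted_enum (levels E) (desym_eigenvalue \<sigma>)"
proof -
  have "\<exists>!lam. sorted_enum (levels E) lam"
    using sorted_enum_exists[OF infinite_levels finite_levels_below[OF assms(2)]]
      sorted_enum_unique[OF _ _ finite_levels_below[OF assms(2)]] by blast
  from theI'[OF this] show ?thesis
    unfolding desym_eigenvalue_def assms(1) by (simp add: sorted_enum_def)
qed

text \<open>The indices belonging to the \<open>l\<close>-th band do not depend on the position of the eigenvalues inside their bands. This is what allows the two spectra to be compared index by index.\<close>

lemma block_iff:
  assumes "sorted_enum (levels E) lam" "banded E"
  shows "real l * (real l + 1) \<le> lam n \<and> lam n < real (Suc l) * (real (Suc l) + 1) \<longleftrightarrow>
         n \<in> {(\<Sum>j<l. card (cells j))..<(\<Sum>j<Suc l. card (cells j))}"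
  using sorted_enum_less_iff[OF assms(1) finite_levels_below[OF assms(2)], of n "real l * (real l + 1)"]
    sorted_enum_less_iff[OF assms(1) finite_levels_below[OF assms(2)], of n "real (Suc l) * (real (Suc l) + 1)"]
  unfolding card_levels_below[OF assms(2)] by auto

lemma block_eq_level:
  assumes "sorted_enum (levels E) lam" "banded E"
  shows "lam n \<in> E l ` cells l \<longleftrightarrow>
         n \<in> {(\<Sum>j<l. card (cells j))..<(\<Sum>j<Suc l. card (cells j))}"
proof -
  obtain b where b: "bij_betw b UNIV (levels E)" "\<And>n. lam n = snd (b n)"
    using assms(1) by (auto simp: sorted_enum_def)
  have "b n \<in> levels E" using b(1) by (auto simp: bij_betw_def)
  then obtain m j where mj: "lam n = E j m" "m \<in> cells j" using b(2) by (auto simp: levels_def)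
  have "lam n \<in> E l ` cells l" if "real l * (real l + 1) \<le> lam n" "lam n < real (Suc l) * (real (Suc l) + 1)"
    using band_less_iff[OF assms(2) mj(2), of l] band_less_iff[OF assms(2) mj(2), of "Suc l"] that mj
    by (auto simp: less_Suc_eq)
  moreover have "real l * (real l + 1) \<le> lam n \<and> lam n < real (Suc l) * (real (Suc l) + 1)" if "lam n \<in> E l ` cells l"
    using that assms(2) by (auto simp: banded_def)
  ultimately show ?thesis unfolding block_iff[OF assms, symmetric] by blast
qed

lemma sum_block:
  assumes "sorted_enum (levels E) lam" "banded E"
  shows "(\<Sum>n\<in>{(\<Sum>j<l. card (cells j))..<(\<Sum>j<Suc l. card (cells j))}. lam n) = (\<Sum>m\<in>cells l. E l m)"
proof -
  let ?B = "{(\<Sum>j<l. card (cells j))..<(\<Sum>j<Suc l. card (cells j))}"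
  obtain b where b: "bij_betw b UNIV (levels E)" "\<And>n. lam n = snd (b n)"
    using assms(1) by (auto simp: sorted_enum_def)
  have "bij_betw b ?B ((\<lambda>m. (m, E l m)) ` cells l)"
  proof (rule bij_betw_subset[OF b(1)])
    show "b ` ?B = (\<lambda>m. (m, E l m)) ` cells l"
    proof (intro subset_antisym subsetI)
      fix a assume "a \<in> b ` ?B"
      then obtain n where n: "a = b n" "n \<in> ?B" by auto
      then have "b n \<in> levels E" using b(1) by (auto simp: bij_betw_def)
      then obtain m j where mj: "b n = (m, E j m)" "m \<in> cells j" by (auto simp: levels_def)
      then have "real l * (real l + 1) \<le> E j m" "E j m < real (Suc l) * (real (Suc l) + 1)"
        using block_iff[OF assms, of l n] n(2) b(2)[of n] by auto
      then have "j = l"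
        using band_less_iff[OF assms(2) mj(2), of l] band_less_iff[OF assms(2) mj(2), of "Suc l"] by auto
      then show "a \<in> (\<lambda>m. (m, E l m)) ` cells l" using mj n by auto
    next
      fix a assume "a \<in> (\<lambda>m. (m, E l m)) ` cells l"
      then obtain m where m: "a = (m, E l m)" "m \<in> cells l" by auto
      then have "a \<in> levels E" by (auto simp: levels_def)
      then obtain n where n: "b n = a" using b(1) unfolding bij_betw_def by (metis imageE)
      then have "lam n \<in> E l ` cells l" using b(2) m by auto
      then show "a \<in> b ` ?B" unfolding block_eq_level[OF assms] using n by blast
    qed
  qed auto
  then have "(\<Sum>n\<in>?B. snd (b n)) = (\<Sum>a\<in>(\<lambda>m. (m, E l m)) ` cells l. snd a)"
    by (rule sum.reindex_bij_betw)
  also have "\<dots> = (\<Sum>m\<in>cells l. E l m)"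
    by (subst sum.reindex) (auto simp: inj_on_def)
  finally show ?thesis by (simp only: b(2))
qed

section \<open>The average gap of a cluster\<close>

lemma gamma_ratio_Suc:
  assumes "x > 0"
  shows "gamma_ratio (x + 1) = gamma_ratio x * ((x + 1/2) / x)"
proof -
  have 1: "gamma_ratio x * gamma_ratio (x + 1/2) = x" by (rule gamma_ratio_mult_shift[OF assms])
  have "x + 1/2 > 0" "x + 1/2 + 1/2 = x + 1" using assms by simp_all
  then have 2: "gamma_ratio (x + 1/2) * gamma_ratio (x + 1) = x + 1/2" using gamma_ratio_mult_shift[of "x + 1/2"] by metis
  have "gamma_ratio (x + 1) * x = gamma_ratio x * (gamma_ratio (x + 1/2) * gamma_ratio (x + 1))"
    by (subst 1[symmetric]) (simp add: mult_ac)
  then show ?thesis unfolding 2 using assms by (simp add: field_simps)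
qed

lemma gamma_ratio_shift_le:
  assumes "x > 0" "h \<ge> 0"
  shows "gamma_ratio (x + h) \<le> gamma_ratio x * ((x + h) / x)"
proof -
  have pos: "gamma_ratio (x + h) > 0"
    using assms by (auto intro!: gamma_ratio_pos)
  have "gamma_ratio (x + h) * gamma_ratio (x + 1/2) \<le> gamma_ratio (x + h) * gamma_ratio (x + h + 1/2)"
    using assms pos by (intro mult_left_mono gamma_ratio_mono) auto
  also have "\<dots> = x + h" using gamma_ratio_mult_shift[of "x + h"] assms by simp
  finally have "gamma_ratio (x + h) * gamma_ratio (x + 1/2) * gamma_ratio x \<le> (x + h) * gamma_ratio x"
    using gamma_ratio_pos[OF assms(1)] by (intro mult_right_mono) auto
  moreover have "gamma_ratio (x + h) * gamma_ratio (x + 1/2) * gamma_ratio x = gamma_ratio (x + h) * x"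
    by (subst (4) gamma_ratio_mult_shift[OF assms(1), symmetric]) (simp add: mult_ac)
  ultimately have "gamma_ratio (x + h) * x \<le> (x + h) * gamma_ratio x" by simp
  then show ?thesis using assms by (simp add: field_simps)
qed

text \<open>Raising \<open>m\<close> by 2 moves the two arguments of \<open>gamma_prod\<close> apart by 1 each, and \<open>gamma_ratio (x + 1) / gamma_ratio x = 1 + 1 / (2 x)\<close> decreases in \<open>x\<close>.\<close>

lemma gamma_prod_step_less:
  assumes "real m + 2 < \<nu>"
  shows "gamma_prod (m + 2) \<nu> < gamma_prod m \<nu>"
proof -
  define x y where "x = (\<nu> - real m - 1) / 2" and "y = (\<nu> + real m + 1) / 2"
  have xy: "x > 0" "y > 0" using assms by (auto simp: x_def y_def)
  have "gamma_prod (m + 2) \<nu> = gamma_ratio x * gamma_ratio (y + 1)" "gamma_prod m \<nu> = gamma_ratio (x + 1) * gamma_ratio y"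
    by (simp_all add: gamma_prod_def x_def y_def field_simps)
  then have "gamma_prod (m + 2) \<nu> = gamma_ratio x * gamma_ratio y * ((y + 1/2) / y)" "gamma_prod m \<nu> = gamma_ratio x * gamma_ratio y * ((x + 1/2) / x)"
    using gamma_ratio_Suc[OF xy(1)] gamma_ratio_Suc[OF xy(2)] by simp_all
  moreover have "(y + 1/2) / y < (x + 1/2) / x"
    using xy by (simp add: field_simps) (simp add: x_def y_def)
  moreover have "gamma_ratio x * gamma_ratio y > 0" using xy by (simp add: gamma_ratio_pos)
  ultimately show ?thesis by (metis mult_strict_left_mono)
qed

lemma gamma_prod_strict_decreasing:
  assumes "real (m + 2 * Suc k) < \<nu>"
  shows "gamma_prod (m + 2 * Suc k) \<nu> < gamma_prod m \<nu>"
  using assms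
proof (induction k)
  case 0
  then show ?case using gamma_prod_step_less[of m \<nu>] by simp
next
  case (Suc k)
  have "gamma_prod (m + 2 * Suc k + 2) \<nu> < gamma_prod (m + 2 * Suc k) \<nu>"
    using Suc.prems by (intro gamma_prod_step_less) simp
  also have "\<dots> < gamma_prod m \<nu>" using Suc by simp
  finally show ?case by simp
qed

lemma cluster_eq_image: "cluster l \<sigma> = (\<lambda>m. Lam l m \<sigma>) ` cells l"
  by (auto simp: cluster_def cells_def)

text \<open>A common root of the secular equations of two sectors would give equal values of \<open>gamma_prod\<close>, since the tangent is positive and the same for both; but \<open>gamma_prod\<close> strictly decreases in
\<open>m\<close>. So the cluster, as a set, has as many elements as there
are sectors.\<close>

lemma inj_on_Lam:
  assumes "\<sigma> > 0"
  shows "inj_on (\<lambda>m. Lam l m \<sigma>) (cells l)"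
proof (rule linorder_inj_onI')
  fix m m' assume mm: "m \<in> cells l" "m' \<in> cells l" "m < m'"
  show "Lam l m \<sigma> \<noteq> Lam l m' \<sigma>"
  proof
    assume eq: "Lam l m \<sigma> = Lam l m' \<sigma>"
    have c: "m \<le> l" "m mod 2 = l mod 2" "m' \<le> l" "m' mod 2 = l mod 2"
      using mm by (auto simp: cells_def)
    define \<nu> where "\<nu> = nu l m \<sigma>"
    note nu = nu_props[OF c(1,2) assms, folded \<nu>_def] and nu' = nu_props[OF c(3,4) assms]
    have "(\<nu> - nu l m' \<sigma>) * (\<nu> + nu l m' \<sigma> + 1) = 0"
      using eq by (simp add: Lam_def \<nu>_def algebra_simps)
    moreover have "\<nu> + nu l m' \<sigma> + 1 > 0" using nu nu' by simp
    ultimately have same: "nu l m' \<sigma> = \<nu>" by simp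
    have "0 < tan (pi * (\<nu> - real l) / 2)"
      using cell_angle[of l \<nu>] nu by (intro tan_gt_zero) auto
    moreover have "S m \<nu> = S m' \<nu>" using nu nu' same by simp
    ultimately have "gamma_prod m \<nu> = gamma_prod m' \<nu>"
      unfolding S_in_cell[OF c(1,2)] S_in_cell[OF c(3,4)] by simp
    moreover obtain k where "m' = m + 2 * Suc k"
    proof -
      have "m mod 2 = m' mod 2" "m \<le> m'" using c mm by auto
      then obtain k where "m' = m + 2 * k" using mod2_eq_iff by blast
      then show ?thesis using mm that by (cases k) auto
    qed
    moreover have "real m' < \<nu>" using nu(1) c(3) by simp
    ultimately show False using gamma_prod_strict_decreasing[of m k \<nu>] by simp
  qed
qed

lemma cells_eq_image: "cells l = (\<lambda>j. l - 2 * j) ` {..l div 2}"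
proof (intro subset_antisym subsetI)
  fix m assume "m \<in> cells l"
  then obtain k where "l = m + 2 * k" using mod2_eq_iff by (auto simp: cells_def)
  then show "m \<in> (\<lambda>j. l - 2 * j) ` {..l div 2}" by (intro image_eqI[of _ _ k]) auto
next
  fix m assume "m \<in> (\<lambda>j. l - 2 * j) ` {..l div 2}"
  then obtain j where "m = l - 2 * j" "j \<le> l div 2" by auto
  then have "l = m + 2 * j" by simp
  then show "m \<in> cells l" by (simp add: cells_def)
qed

lemma inj_on_cells: "inj_on (\<lambda>j. l - 2 * j) {..l div (2::nat)}"
  by (auto simp: inj_on_def)

lemma card_cells: "card (cells l) = l div 2 + 1"
  unfolding cells_eq_image by (simp add: card_image[OF inj_on_cells])

text \<open>Up to the factor \<open>sqrt \<pi>\<close> this is the Taylor coefficient of \<open>(1 - x)\<^sup>-\<^sup>1\<^sup>/\<^sup>2\<close>, the normalized central binomial coefficient.\<close>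

lemma inverse_gamma_ratio_half: "1 / gamma_ratio (real k + 1/2) = sqrt pi * pochhammer (1/2) k / fact k"
proof -
  have "(1/2 :: real) \<notin> \<int>\<^sub>\<le>\<^sub>0" by (auto elim!: nonpos_Ints_cases)
  then have "pochhammer (1/2) k = Gamma (1/2 + real k) / Gamma (1/2 :: real)"
    by (rule pochhammer_Gamma)
  then have "Gamma (real k + 1/2) = sqrt pi * pochhammer (1/2) k"
    by (simp add: Gamma_one_half_real add.commute)
  moreover have "Gamma (real k + 1) = fact k" using Gamma_fact[of k, where 'a = real] by (simp add: add.commute)
  moreover have "real k + 1/2 + 1/2 = real k + 1" by simp
  ultimately show ?thesis unfolding gamma_ratio_def by (simp only:) simp
qed

text \<open>The Vandermonde convolution for \<open>(1 - x)\<^sup>-\<^sup>1\<^sup>/\<^sup>2 (1 - x)\<^sup>-\<^sup>1\<^sup>/\<^sup>2 = (1 - x)\<^sup>-\<^sup>1\<close>.\<close>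

lemma sum_inverse_gamma_ratio:
  "(\<Sum>k\<le>l. 1 / (gamma_ratio (real k + 1/2) * gamma_ratio (real (l - k) + 1/2))) = pi"
proof -
  have "(\<Sum>k\<le>l. 1 / (gamma_ratio (real k + 1/2) * gamma_ratio (real (l - k) + 1/2))) =
      (\<Sum>k\<le>l. pi / fact l * (real (l choose k) * pochhammer (1/2) k * pochhammer (1/2) (l - k)))"
  proof (rule sum.cong)
    fix k assume "k \<in> {..l}"
    then have b: "real (l choose k) = fact l / (fact k * fact (l - k))" by (intro binomial_fact) auto
    have "1 / (gamma_ratio (real k + 1/2) * gamma_ratio (real (l - k) + 1/2)) = (1 / gamma_ratio (real k + 1/2)) * (1 / gamma_ratio (real (l - k) + 1/2))"
      by simp
    also have "\<dots> = (sqrt pi * sqrt pi) * (pochhammer (1/2) k * pochhammer (1/2) (l - k)) / (fact k * fact (l - k))"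
      unfolding inverse_gamma_ratio_half by simp
    also have "sqrt pi * sqrt pi = pi" by simp
    finally show "1 / (gamma_ratio (real k + 1/2) * gamma_ratio (real (l - k) + 1/2)) =
        pi / fact l * (real (l choose k) * pochhammer (1/2) k * pochhammer (1/2) (l - k))"
      unfolding b by simp
  qed simp
  also have "\<dots> = pi / fact l * (\<Sum>k\<le>l. real (l choose k) * pochhammer (1/2) k * pochhammer (1/2) (l - k))"
    by (simp only: sum_distrib_left)
  also have "(\<Sum>k\<le>l. real (l choose k) * pochhammer (1/2) k * pochhammer (1/2) (l - k)) = pochhammer (1/2 + 1/2) l"
    by (rule pochhammer_binomial_sum[symmetric])
  also have "pochhammer (1/2 + 1/2) l = (fact l :: real)" by (simp add: pochhammer_fact)
  finally show ?thesis by simp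
qed

definition cluster_weight :: "nat \<Rightarrow> real" where
  "cluster_weight l = (\<Sum>m\<in>cells l. 1 / gamma_prod m (real l))"

lemma gamma_ratio_square_ge:
  assumes "x > 1/2"
  shows "(gamma_ratio x)\<^sup>2 \<ge> x - 1/2"
proof -
  have "x - 1/2 = gamma_ratio (x - 1/2) * gamma_ratio x" using gamma_ratio_mult_shift[of "x - 1/2"] assms by simp
  also have "\<dots> \<le> gamma_ratio x * gamma_ratio x"
    using assms by (intro mult_right_mono gamma_ratio_mono less_imp_le[OF gamma_ratio_pos]) auto
  finally show ?thesis by (simp add: power2_eq_square)
qed

text \<open>With \<open>m = l - 2 j\<close> the terms are those of the convolution with \<open>j \<le> l / 2\<close>. By symmetry they make up half of it, except that for even \<open>l\<close> the middle term (\<open>m = 0\<close>) is counted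
in full.\<close>

lemma cluster_weight_bounds:
  assumes "l \<ge> 1"
  shows "pi / 2 \<le> cluster_weight l" "cluster_weight l \<le> pi / 2 + 1 / real l"
proof -
  define t where "t k = 1 / (gamma_ratio (real k + 1/2) * gamma_ratio (real (l - k) + 1/2))" for k
  have t0: "t k \<ge> 0" for k
    unfolding t_def by (intro divide_nonneg_nonneg mult_nonneg_nonneg less_imp_le[OF gamma_ratio_pos]) auto
  let ?A = "{..l div 2}" and ?B = "{l - l div 2..l}"
  have "cluster_weight l = (\<Sum>j\<in>?A. 1 / gamma_prod (l - 2 * j) (real l))"
    unfolding cluster_weight_def cells_eq_image by (subst sum.reindex[OF inj_on_cells]) simp
  also have "\<dots> = sum t ?A"
  proof (rule sum.cong)
    fix j assume "j \<in> ?A"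
    then have "2 * j \<le> l" by auto
    then have "(real l - real (l - 2 * j) + 1) / 2 = real j + 1/2"
        "(real l + real (l - 2 * j) + 1) / 2 = real (l - j) + 1/2"
      by (auto simp: of_nat_diff field_simps)
    then show "1 / gamma_prod (l - 2 * j) (real l) = t j" unfolding gamma_prod_def t_def by (simp only:)
  qed simp
  finally have WA: "cluster_weight l = sum t ?A" .
  have AB: "sum t ?A = sum t ?B"
    by (rule sum.reindex_bij_witness[of _ "\<lambda>k. l - k" "\<lambda>k. l - k"]) (auto simp: t_def mult.commute)
  have "sum t ?A + sum t ?B = sum t (?A \<union> ?B) + sum t (?A \<inter> ?B)"
    by (rule sum.union_inter[symmetric]) auto
  also have "?A \<union> ?B = {..l}" by auto
  also have "sum t {..l} = pi" unfolding t_def by (rule sum_inverse_gamma_ratio)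
  finally have 2: "2 * cluster_weight l = pi + sum t (?A \<inter> ?B)" using WA AB by simp
  have I: "0 \<le> sum t (?A \<inter> ?B)" by (intro sum_nonneg t0)
  have J: "sum t (?A \<inter> ?B) \<le> 2 / real l"
  proof (cases "even l")
    case True
    then obtain h where h: "l = 2 * h" by (elim evenE)
    then have "?A \<inter> ?B = {h}" by auto
    then have "sum t (?A \<inter> ?B) = 1 / (gamma_ratio (real h + 1/2))\<^sup>2"
      using h by (simp add: t_def power2_eq_square)
    also have "\<dots> \<le> 1 / real h"
      using gamma_ratio_square_ge[of "real h + 1/2"] h assms zero_less_power[OF gamma_ratio_pos[of "real h + 1/2"], of 2] by (intro divide_left_mono) auto
    finally show ?thesis using h by simp
  next
    case False
    then have "?A \<inter> ?B = {}" by auto presburger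
    then show ?thesis by simp
  qed
  show "pi / 2 \<le> cluster_weight l" "cluster_weight l \<le> pi / 2 + 1 / real l"
    using 2 I J by auto
qed

text \<open>A bound on \<open>nu l m \<sigma> - l\<close> that is uniform in \<open>m\<close>. The worst case is \<open>m = l\<close>, where \<open>gamma_prod\<close> grows only like \<open>sqrt l\<close>.\<close>

definition gap_bound :: "real \<Rightarrow> nat \<Rightarrow> real" where
  "gap_bound \<sigma> l = \<sigma> / (pi * (gamma_ratio (1/2) * sqrt (real l / 2)))"

lemma gamma_prod_lower_bound:
  assumes "m \<le> l" "l \<ge> 1"
  shows "gamma_ratio (1/2) * sqrt (real l / 2) \<le> gamma_prod m (real l)"
  unfolding gamma_prod_def
proof (intro mult_mono)
  show "gamma_ratio (1/2) \<le> gamma_ratio ((real l - real m + 1) / 2)" using assms by (intro gamma_ratio_mono) auto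
  have "sqrt (real l / 2) \<le> gamma_ratio ((real l + 1) / 2)"
    using gamma_ratio_square_ge[of "(real l + 1) / 2"] gamma_ratio_pos[of "(real l + 1) / 2"] assms
    by (intro real_le_lsqrt) (auto simp: field_simps)
  also have "\<dots> \<le> gamma_ratio ((real l + real m + 1) / 2)" by (intro gamma_ratio_mono) auto
  finally show "sqrt (real l / 2) \<le> gamma_ratio ((real l + real m + 1) / 2)" .
  show "0 \<le> gamma_ratio ((real l - real m + 1) / 2)" using assms by (intro less_imp_le[OF gamma_ratio_pos]) auto
qed auto

lemma gamma_prod_upper_growth:
  assumes "m \<le> l" "0 \<le> \<delta>"
  shows "gamma_prod m (real l + \<delta>) \<le> gamma_prod m (real l) * (1 + \<delta>)\<^sup>2"
proof -
  have *: "gamma_ratio (x + \<delta> / 2) \<le> gamma_ratio x * (1 + \<delta>)" if "x \<ge> 1/2" for x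
  proof -
    have "gamma_ratio (x + \<delta> / 2) \<le> gamma_ratio x * ((x + \<delta> / 2) / x)"
      using that assms by (intro gamma_ratio_shift_le) auto
    also have "\<dots> \<le> gamma_ratio x * (1 + \<delta>)"
    proof (intro mult_left_mono)
      show "(x + \<delta> / 2) / x \<le> 1 + \<delta>"
        using that assms mult_right_mono[of "1/2" x \<delta>] by (simp add: field_simps)
      show "0 \<le> gamma_ratio x" using that by (intro less_imp_le[OF gamma_ratio_pos]) auto
    qed
    finally show ?thesis .
  qed
  define x y where "x = (real l - real m + 1) / 2" and "y = (real l + real m + 1) / 2"
  have xy: "x \<ge> 1/2" "y \<ge> 1/2" using assms by (auto simp: x_def y_def)
  have "gamma_prod m (real l + \<delta>) = gamma_ratio (x + \<delta> / 2) * gamma_ratio (y + \<delta> / 2)"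
    by (simp add: gamma_prod_def x_def y_def field_simps)
  also have "\<dots> \<le> (gamma_ratio x * (1 + \<delta>)) * (gamma_ratio y * (1 + \<delta>))"
    using xy assms by (intro mult_mono * mult_nonneg_nonneg less_imp_le[OF gamma_ratio_pos]) auto
  also have "\<dots> = gamma_prod m (real l) * (1 + \<delta>)\<^sup>2"
    by (simp add: gamma_prod_def x_def y_def power2_eq_square)
  finally show ?thesis .
qed

text \<open>Solve \<open>2 G tan (\<pi> \<delta> / 2) = \<sigma>\<close> approximately. The upper bound uses \<open>x \<le> tan x\<close> and the monotonicity of \<open>G\<close>. The lower bound uses
\<open>tan x \<le> x / cos x\<close> and the slow growth of \<open>G\<close>; both corrections are controlled by the uniform bound \<open>\<eta>\<close>.\<close>

lemma nu_gap_bounds: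
  assumes \<sigma>: "\<sigma> > 0" and m: "m \<in> cells l" and l: "l \<ge> 1" and small: "gap_bound \<sigma> l \<le> 1"
  defines "\<delta> \<equiv> nu l m \<sigma> - real l" and "\<eta> \<equiv> gap_bound \<sigma> l"
  shows "\<delta> \<le> \<sigma> / pi * (1 / gamma_prod m (real l))"
    and "\<sigma> / pi * (1 / gamma_prod m (real l)) * (cos (pi * \<eta> / 2) / (1 + \<eta>)\<^sup>2) \<le> \<delta>"
    and "0 < \<delta>" "\<delta> < 1"
proof -
  have c: "m \<le> l" "m mod 2 = l mod 2" using m by (auto simp: cells_def)
  note nu = nu_props[OF c \<sigma>]
  have nu_eq: "nu l m \<sigma> = real l + \<delta>" by (simp add: \<delta>_def)
  show d: "0 < \<delta>" "\<delta> < 1" using nu by (auto simp: \<delta>_def)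
  define x where "x = pi * \<delta> / 2"
  have x: "0 < x" "x < pi/2" using d by (auto simp: x_def)
  have G0: "gamma_prod m (real l) > 0" "gamma_prod m (real l + \<delta>) > 0" using c d by (auto intro!: gamma_prod_pos)
  \<comment> \<open>the secular equation \<open>S m \<nu> = \<sigma>\<close> in terms of the small angle \<open>x\<close>\<close>
  have eq: "2 * tan x * gamma_prod m (real l + \<delta>) = \<sigma>"
    using nu(3) unfolding S_in_cell[OF c] x_def nu_eq by simp
  then have tan_eq: "tan x = \<sigma> / (2 * gamma_prod m (real l + \<delta>))" using G0 by (simp add: field_simps)
  have "x = arctan (tan x)" using x by (simp add: arctan_tan)
  also have "\<dots> \<le> tan x" using tan_gt_zero[OF x] by (intro arctan_le_self) simp
  also have "\<dots> \<le> \<sigma> / (2 * gamma_prod m (real l))"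
    unfolding tan_eq using \<sigma> G0 d gamma_prod_mono[of m "real l" "real l + \<delta>"] c by (intro divide_left_mono) auto
  finally have "x \<le> \<sigma> / (2 * gamma_prod m (real l))" .
  then show up: "\<delta> \<le> \<sigma> / pi * (1 / gamma_prod m (real l))"
    using G0 by (simp add: x_def field_simps)
  have "\<sigma> / pi * (1 / gamma_prod m (real l)) = \<sigma> / (pi * gamma_prod m (real l))" by simp
  also have "\<dots> \<le> \<eta>"
    unfolding \<eta>_def gap_bound_def using \<sigma> G0 gamma_prod_lower_bound[OF c(1) l] l gamma_ratio_pos[of "1/2"]
    by (intro divide_left_mono mult_left_mono) auto
  finally have \<delta>\<eta>: "\<delta> \<le> \<eta>" using up by simp
  have cos_le: "cos (pi * \<eta> / 2) \<le> cos x"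
    unfolding x_def using \<delta>\<eta> d small by (intro cos_monotone_0_pi_le) (auto simp: \<eta>_def)
  have c0: "0 \<le> cos (pi * \<eta> / 2)"
    using small \<delta>\<eta> d by (intro cos_ge_zero) (auto simp: \<eta>_def intro: order_trans[of _ 0])
  have "\<sigma> / pi * (1 / gamma_prod m (real l)) * (cos (pi * \<eta> / 2) / (1 + \<eta>)\<^sup>2) =
      \<sigma> * cos (pi * \<eta> / 2) / (pi * (gamma_prod m (real l) * (1 + \<eta>)\<^sup>2))" by simp
  also have "\<dots> \<le> \<sigma> * cos x / (pi * gamma_prod m (real l + \<delta>))"
  proof (rule frac_le)
    show "0 \<le> \<sigma> * cos x" using \<sigma> c0 cos_le by (intro mult_nonneg_nonneg) auto
    show "\<sigma> * cos (pi * \<eta> / 2) \<le> \<sigma> * cos x" using \<sigma> cos_le by (intro mult_left_mono) auto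
    show "0 < pi * gamma_prod m (real l + \<delta>)" using G0 by simp
    have "gamma_prod m (real l + \<delta>) \<le> gamma_prod m (real l) * (1 + \<delta>)\<^sup>2" using c d by (intro gamma_prod_upper_growth) auto
    also have "\<dots> \<le> gamma_prod m (real l) * (1 + \<eta>)\<^sup>2"
      using G0 \<delta>\<eta> d by (intro mult_left_mono power_mono) auto
    finally show "pi * gamma_prod m (real l + \<delta>) \<le> pi * (gamma_prod m (real l) * (1 + \<eta>)\<^sup>2)" by (intro mult_left_mono) auto
  qed
  also have "\<dots> = 2 / pi * (tan x * cos x)" by (simp add: tan_eq)
  also have "tan x * cos x = sin x" using x cos_gt_zero[of x] by (simp add: tan_def)
  also have "2 / pi * sin x \<le> 2 / pi * x" using x by (intro mult_left_mono sin_x_le_x) auto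
  also have "\<dots> = \<delta>" by (simp add: x_def)
  finally show "\<sigma> / pi * (1 / gamma_prod m (real l)) * (cos (pi * \<eta> / 2) / (1 + \<eta>)\<^sup>2) \<le> \<delta>" .
qed

lemma Lam_gap: "Lam l m \<sigma> - real l * (real l + 1) = (nu l m \<sigma> - real l) * (2 * real l + 1 + (nu l m \<sigma> - real l))"
  by (simp add: Lam_def algebra_simps)

lemma banded_Lam:
  assumes "\<sigma> > 0"
  shows "banded (\<lambda>l m. Lam l m \<sigma>)"
  unfolding banded_def
proof (intro allI ballI conjI)
  fix l m assume "m \<in> cells l"
  then have nu: "real l < nu l m \<sigma>" "nu l m \<sigma> < real l + 1"
    using nu_props[of m l \<sigma>] assms by (auto simp: cells_def)
  show "real l * (real l + 1) \<le> Lam l m \<sigma>"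
    unfolding Lam_def using nu by (intro mult_mono) auto
  show "Lam l m \<sigma> < real (Suc l) * (real (Suc l) + 1)"
    unfolding Lam_def using nu by (intro mult_strict_mono) auto
qed

lemma banded_neumann: "banded (\<lambda>l m. real l * (real l + 1))"
  unfolding banded_def by (auto intro!: mult_strict_mono)

text \<open>In both spectra the \<open>l\<close>-th level occupies the same block of indices.\<close>

lemma sum_rn_gap:
  assumes "\<sigma> > 0"
  shows "(\<Sum>n | desym_eigenvalue \<sigma> n \<in> cluster l \<sigma>. rn_gap \<sigma> n) =
         (\<Sum>m\<in>cells l. Lam l m \<sigma> - real l * (real l + 1))"
proof -
  let ?B = "{(\<Sum>j<l. card (cells j))..<(\<Sum>j<Suc l. card (cells j))}"
  have sR: "desym_spectrum \<sigma> = levels (\<lambda>l m. Lam l m \<sigma>)"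
    unfolding desym_spectrum_robin[OF assms] levels_def cells_def by simp
  have sN: "desym_spectrum 0 = levels (\<lambda>l m. real l * (real l + 1))"
    unfolding desym_spectrum_neumann levels_def cells_def by simp
  note R = sorted_enum_desym_eigenvalue[OF sR banded_Lam[OF assms]]
  note N = sorted_enum_desym_eigenvalue[OF sN banded_neumann]
  have "{n. desym_eigenvalue \<sigma> n \<in> cluster l \<sigma>} = ?B"
    using block_eq_level[OF R banded_Lam[OF assms], of _ l] unfolding cluster_eq_image by blast
  then have "(\<Sum>n | desym_eigenvalue \<sigma> n \<in> cluster l \<sigma>. rn_gap \<sigma> n) =
      (\<Sum>n\<in>?B. desym_eigenvalue \<sigma> n) - (\<Sum>n\<in>?B. desym_eigenvalue 0 n)"
    unfolding rn_gap_def by (simp add: sum_subtractf)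
  also have "\<dots> = (\<Sum>m\<in>cells l. Lam l m \<sigma>) - (\<Sum>m\<in>cells l. real l * (real l + 1))"
    unfolding sum_block[OF R banded_Lam[OF assms]] sum_block[OF N banded_neumann] ..
  finally show ?thesis by (simp add: sum_subtractf)
qed

theorem corollary5p3:
  fixes \<sigma> :: real
  assumes "\<sigma> > 0"
  shows "(\<lambda>l. (1 / real (card (cluster l \<sigma>))) *
            (\<Sum>n | desym_eigenvalue \<sigma> n \<in> cluster l \<sigma>. rn_gap \<sigma> n))
         \<sim>[at_top] (\<lambda>_. 2 * \<sigma>)"
proof (rule tendsto_imp_asymp_equiv_const)
  show "2 * \<sigma> \<noteq> 0" using assms by simp
  define \<eta> where "\<eta> = gap_bound \<sigma>"
  define D where "D l = (\<Sum>m\<in>cells l. Lam l m \<sigma> - real l * (real l + 1))" for l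
  have eq: "(1 / real (card (cluster l \<sigma>))) * (\<Sum>n | desym_eigenvalue \<sigma> n \<in> cluster l \<sigma>. rn_gap \<sigma> n) =
      D l / real (l div 2 + 1)" for l
  proof -
    have "card (cluster l \<sigma>) = l div 2 + 1"
      unfolding cluster_eq_image card_image[OF inj_on_Lam[OF assms]] by (rule card_cells)
    then show ?thesis unfolding sum_rn_gap[OF assms] D_def by simp
  qed
  have \<eta>0: "\<eta> \<longlonglongrightarrow> 0"
  proof -
    have "(\<lambda>l. \<sigma> / (pi * gamma_ratio (1/2)) * (1 / sqrt (real l / 2))) \<longlonglongrightarrow> \<sigma> / (pi * gamma_ratio (1/2)) * 0"
      by (intro tendsto_mult tendsto_const) real_asymp
    then show ?thesis by (simp add: \<eta>_def gap_bound_def[abs_def] mult.assoc)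
  qed
  have W_lim: "cluster_weight \<longlonglongrightarrow> pi / 2"
  proof (rule tendsto_sandwich)
    show "\<forall>\<^sub>F l in sequentially. pi / 2 \<le> cluster_weight l" "\<forall>\<^sub>F l in sequentially. cluster_weight l \<le> pi / 2 + 1 / real l"
      using eventually_ge_at_top[of 1] by (eventually_elim, use cluster_weight_bounds in blast)+
    show "(\<lambda>l. pi / 2 + 1 / real l) \<longlonglongrightarrow> pi / 2" by real_asymp
  qed auto
  have ev: "\<forall>\<^sub>F l in sequentially. l \<ge> 1 \<and> \<eta> l \<le> 1"
    using eventually_ge_at_top[of 1] order_tendstoD(2)[OF \<eta>0 zero_less_one]
    by eventually_elim auto
  \<comment> \<open>the factor lost in the lower bound for the individual gaps\<close>
  define \<rho> where "\<rho> l = cos (pi * \<eta> l / 2) / (1 + \<eta> l)\<^sup>2" for l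
  have \<rho>: "\<rho> \<longlonglongrightarrow> 1"
  proof -
    have "(\<lambda>l. cos (pi * \<eta> l / 2) / (1 + \<eta> l)\<^sup>2) \<longlonglongrightarrow> cos (pi * 0 / 2) / (1 + 0)\<^sup>2"
      by (intro tendsto_intros \<eta>0) auto
    then show ?thesis by (simp add: \<rho>_def[abs_def])
  qed
  have upper: "D l \<le> \<sigma> / pi * cluster_weight l * (2 * real l + 2)" if "l \<ge> 1" "\<eta> l \<le> 1" for l
  proof -
    have "D l \<le> (\<Sum>m\<in>cells l. \<sigma> / pi * (1 / gamma_prod m (real l)) * (2 * real l + 2))"
      unfolding D_def Lam_gap
    proof (intro sum_mono mult_mono)
      fix m assume "m \<in> cells l"
      note gap = nu_gap_bounds[OF assms this that[unfolded \<eta>_def]]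
      show "nu l m \<sigma> - real l \<le> \<sigma> / pi * (1 / gamma_prod m (real l))" by (rule gap)
      show "2 * real l + 1 + (nu l m \<sigma> - real l) \<le> 2 * real l + 2" using gap by simp
      show "0 \<le> \<sigma> / pi * (1 / gamma_prod m (real l))" using gap(1,3) by simp
      show "0 \<le> 2 * real l + 1 + (nu l m \<sigma> - real l)" using gap by simp
    qed
    also have "\<dots> = \<sigma> / pi * cluster_weight l * (2 * real l + 2)"
      unfolding cluster_weight_def sum_distrib_left sum_distrib_right ..
    finally show ?thesis .
  qed
  have lower: "\<sigma> / pi * cluster_weight l * \<rho> l * (2 * real l + 1) \<le> D l" if "l \<ge> 1" "\<eta> l \<le> 1" for l
  proof -
    have "\<sigma> / pi * cluster_weight l * \<rho> l * (2 * real l + 1) =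
        (\<Sum>m\<in>cells l. \<sigma> / pi * (1 / gamma_prod m (real l)) * \<rho> l * (2 * real l + 1))"
      unfolding cluster_weight_def sum_distrib_left sum_distrib_right ..
    also have "\<dots> \<le> D l"
      unfolding D_def Lam_gap
    proof (intro sum_mono mult_mono)
      fix m assume "m \<in> cells l"
      note gap = nu_gap_bounds[OF assms this that[unfolded \<eta>_def]]
      show "\<sigma> / pi * (1 / gamma_prod m (real l)) * \<rho> l \<le> nu l m \<sigma> - real l"
        unfolding \<rho>_def \<eta>_def by (rule gap)
      show "2 * real l + 1 \<le> 2 * real l + 1 + (nu l m \<sigma> - real l)" using gap by simp
      show "0 \<le> nu l m \<sigma> - real l" using gap by simp
    qed simp
    finally show ?thesis .
  qed
  have N: "real (l div 2 + 1) \<le> (real l + 2) / 2" "(real l + 1) / 2 \<le> real (l div 2 + 1)" for l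
  proof -
    have "real (2 * (l div 2)) \<le> real l" "real l \<le> real (2 * (l div 2) + 1)"
      unfolding of_nat_le_iff by presburger+
    then show "real (l div 2 + 1) \<le> (real l + 2) / 2" "(real l + 1) / 2 \<le> real (l div 2 + 1)"
      by simp_all
  qed
  show "(\<lambda>l. (1 / real (card (cluster l \<sigma>))) *
            (\<Sum>n | desym_eigenvalue \<sigma> n \<in> cluster l \<sigma>. rn_gap \<sigma> n)) \<longlonglongrightarrow> 2 * \<sigma>"
    unfolding eq
  proof (rule tendsto_sandwich)
    show "\<forall>\<^sub>F l in sequentially. \<sigma> / pi * cluster_weight l * \<rho> l * ((2 * real l + 1) / ((real l + 2) / 2)) \<le> D l / real (l div 2 + 1)"
      using ev order_tendstoD(1)[OF \<rho>, of 0, simplified] order_tendstoD(1)[OF W_lim, of 0, simplified]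
    proof eventually_elim
      case (elim l)
      have "\<sigma> / pi * cluster_weight l * \<rho> l * ((2 * real l + 1) / ((real l + 2) / 2)) =
          \<sigma> / pi * cluster_weight l * \<rho> l * (2 * real l + 1) / ((real l + 2) / 2)" by simp
      also have "\<dots> \<le> \<sigma> / pi * cluster_weight l * \<rho> l * (2 * real l + 1) / real (l div 2 + 1)"
        using elim assms N(1)[of l] by (intro divide_left_mono mult_nonneg_nonneg divide_nonneg_pos) auto
      also have "\<dots> \<le> D l / real (l div 2 + 1)"
        using lower[of l] elim by (intro divide_right_mono) auto
      finally show ?case .
    qed
    show "\<forall>\<^sub>F l in sequentially. D l / real (l div 2 + 1) \<le> \<sigma> / pi * cluster_weight l * ((2 * real l + 2) / ((real l + 1) / 2))"
      using ev order_tendstoD(1)[OF W_lim, of 0, simplified]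
    proof eventually_elim
      case (elim l)
      have "D l / real (l div 2 + 1) \<le> \<sigma> / pi * cluster_weight l * (2 * real l + 2) / real (l div 2 + 1)"
        using upper[of l] elim by (intro divide_right_mono) auto
      also have "\<dots> \<le> \<sigma> / pi * cluster_weight l * (2 * real l + 2) / ((real l + 1) / 2)"
        using elim assms N(2)[of l] by (intro divide_left_mono mult_nonneg_nonneg divide_nonneg_pos) auto
      finally show ?case by (simp only: times_divide_eq_right)
    qed
    have "(\<lambda>l. \<sigma> / pi * cluster_weight l * \<rho> l * ((2 * real l + 1) / ((real l + 2) / 2))) \<longlonglongrightarrow> \<sigma> / pi * (pi / 2) * 1 * 4"
      by (intro tendsto_mult tendsto_const W_lim \<rho>) real_asymp
    then show "(\<lambda>l. \<sigma> / pi * cluster_weight l * \<rho> l * ((2 * real l + 1) / ((real l + 2) / 2))) \<longlonglongrightarrow> 2 * \<sigma>"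
      by simp
    have "(\<lambda>l. \<sigma> / pi * cluster_weight l * ((2 * real l + 2) / ((real l + 1) / 2))) \<longlonglongrightarrow> \<sigma> / pi * (pi / 2) * 4"
      by (intro tendsto_mult tendsto_const W_lim) real_asymp
    then show "(\<lambda>l. \<sigma> / pi * cluster_weight l * ((2 * real l + 2) / ((real l + 1) / 2))) \<longlonglongrightarrow> 2 * \<sigma>"
      by simp
  qed
qed

end
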